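(* Let $\mathbb{K}$ be a field with $\operatorname{char}(\mathbb{K})=0$, let $G$ be a finite group acting on a nonempty set $E$, let $D=G\times E$ be the associated generalized digroup, and let $Q,W\in\mathsf{Rep}(D)$. Then there is a bijection $$\operatorname{Ext}^1_{\mathsf{Rep}(D)}(Q,W)\cong Z^1(Q,W)/B^1(Q,W).$$ Moreover, the zero class in $Z^1(Q,W)/B^1(Q,W)$ corresponds exactly to the split short exact sequences $0\to W\to V\to Q\to 0$ in $\mathsf{Rep}(D)$.
   Context: Let $G$ be a group with identity $1$ acting on the left on a nonempty set $E$, $(g,\alpha)\mapsto g\bullet\alpha$. The associated generalized digroup is the set $D=G\times E$ with operations $(g,\alpha)\vdash(h,\beta)=(gh,g\bullet\beta)$, $(g,\alpha)\dashv(h,\beta)=(gh,\alpha)$ and halo $\overline{E}=\{(1,\alpha)\mid\alpha\in E\}$. (Every generalized digroup is isomorphic to one of this form.) A representation of $D$ over $\mathbb{K}$ is a triple $(V,\lambda,\rho)$ where $V$ is a $\mathbb{K}$-vector space and $\lambda:D\to\operatorname{End}(V)$, $\rho:D\to\operatorname{Aut}(V)$ are maps such that for all $x,y\in D$ and $e\in\overline{E}$: $\lambda_{x\dashv y}=\lambda_x\lambda_y$, $\rho_{x\vdash y}=\rho_x\rho_y$, $\rho_e=\mathrm{id}_V$, $\rho_x\lambda_y=\lambda_{x\vdash y}$, $\lambda_x\rho_y=\lambda_{x\dashv y}$. A morphism of representations is a $\mathbb{K}$-linear map commuting with all $\lambda_x$ and $\rho_x$. These form the abelian category $\mathsf{Rep}(D)$,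 which has enough injectives and projectives; $\operatorname{Ext}^1_{\mathsf{Rep}(D)}(Q,W)$ is identified (Yoneda) with the set of short exact sequences $0\to W\to V\to Q\to 0$ in $\mathsf{Rep}(D)$ up to the usual equivalence of extensions. For any representation, $\rho_{(g,\alpha)}$ depends only on $g$ and is written $\rho_g$. For $Q,W\in\mathsf{Rep}(D)$, with operators $\lambda^Q,\rho^Q$ and $\lambda^W,\rho^W$: $Z^1(Q,W)$ is the set of all families $\theta=\{\theta_x\}_{x\in D}$ with $\theta_x\in\operatorname{Hom}_{\mathbb{K}}(Q,W)$ such that for all $x,y\in D$: $\theta_{x\dashv y}=\lambda_x^W\theta_y+\theta_x\lambda_y^Q$, $\theta_{x\vdash y}=\rho_x^W\theta_y$, and $\theta_{x\dashv y}=\theta_x\rho_y^Q$. Let $\operatorname{Hom}_\rho(Q,W)=\{t\in\operatorname{Hom}_{\mathbb{K}}(Q,W)\mid\rho_g^Wt=t\rho_g^Q\ \text{for all } g\in G\}$; for such $t$ put $(\delta t)_x=\lambda_x^Wt-t\lambda_x^Q$, $x\in D$. Then $B^1(Q,W)=\{\delta t\mid t\in\operatorname{Hom}_\rho(Q,W)\}$, which is a subspace of $Z^1(Q,W)$. *)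

theory Defs
  imports "HOL-Algebra.Group_Action" "HOL-Algebra.Module" "HOL-Algebra.AbelCoset"
begin

section \<open>Generalized digroups\<close>

record 'd digroup =
  elems :: "'d set"
  vdash :: "'d \<Rightarrow> 'd \<Rightarrow> 'd"
  dashv :: "'d \<Rightarrow> 'd \<Rightarrow> 'd"
  halo  :: "'d set"

definition action_digroup ::
  "('g, 'b) monoid_scheme \<Rightarrow> 'e set \<Rightarrow> ('g \<Rightarrow> 'e \<Rightarrow> 'e) \<Rightarrow> ('g \<times> 'e) digroup" where
  "action_digroup G E \<phi> =
     \<lparr>elems = carrier G \<times> E,
      vdash = (\<lambda>(g, \<alpha>) (h, \<beta>). (g \<otimes>\<^bsub>G\<^esub> h, \<phi> g \<beta>)),
      dashv = (\<lambda>(g, \<alpha>) (h, \<beta>). (g \<otimes>\<^bsub>G\<^esub> h, \<alpha>)),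
      halo = {\<one>\<^bsub>G\<^esub>} \<times> E\<rparr>"


section \<open>Representations and their morphisms\<close>

text \<open>
  Vector spaces are modules over a field \<open>K\<close>, with an explicit carrier.  Linear maps are
  only specified on the carrier; where they are compared as functions (in the spaces of
  cocycles below) they are in addition required to be extensional.
\<close>

definition lin_hom ::
  "('k, 'm) ring_scheme \<Rightarrow> ('k, 'a, 'x) module_scheme \<Rightarrow> ('k, 'b, 'y) module_scheme \<Rightarrow> ('a \<Rightarrow> 'b) set"
where
  "lin_hom K V W = {f \<in> carrier V \<rightarrow> carrier W.
     (\<forall>u\<in>carrier V. \<forall>v\<in>carrier V. f (u \<oplus>\<^bsub>V\<^esub> v) = f u \<oplus>\<^bsub>W\<^esub> f v) \<and>
     (\<forall>c\<in>carrier K. \<forall>v\<in>carrier V. f (c \<odot>\<^bsub>V\<^esub> v) = c \<odot>\<^bsub>W\<^esub> f v)}"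

record ('k, 'v, 'd) rep = "('k, 'v) module" +
  lam :: "'d \<Rightarrow> 'v \<Rightarrow> 'v"
  rho :: "'d \<Rightarrow> 'v \<Rightarrow> 'v"

locale digroup_rep =
  fixes K :: "('k, 'm) ring_scheme"
    and D :: "'d digroup"
    and V :: "('k, 'v, 'd) rep"
  assumes field: "field K"
    and vector_space: "module K V"
    and lam_End: "x \<in> elems D \<Longrightarrow> lam V x \<in> lin_hom K V V"
    and rho_End: "x \<in> elems D \<Longrightarrow> rho V x \<in> lin_hom K V V"
    and rho_bij: "x \<in> elems D \<Longrightarrow> bij_betw (rho V x) (carrier V) (carrier V)"
    and lam_dashv: "\<lbrakk>x \<in> elems D; y \<in> elems D; v \<in> carrier V\<rbrakk>
                      \<Longrightarrow> lam V (dashv D x y) v = lam V x (lam V y v)"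
    and rho_vdash: "\<lbrakk>x \<in> elems D; y \<in> elems D; v \<in> carrier V\<rbrakk>
                      \<Longrightarrow> rho V (vdash D x y) v = rho V x (rho V y v)"
    and rho_halo: "\<lbrakk>e \<in> halo D; v \<in> carrier V\<rbrakk> \<Longrightarrow> rho V e v = v"
    and rho_lam: "\<lbrakk>x \<in> elems D; y \<in> elems D; v \<in> carrier V\<rbrakk>
                      \<Longrightarrow> rho V x (lam V y v) = lam V (vdash D x y) v"
    and lam_rho: "\<lbrakk>x \<in> elems D; y \<in> elems D; v \<in> carrier V\<rbrakk>
                      \<Longrightarrow> lam V x (rho V y v) = lam V (dashv D x y) v"

definition rep_hom ::
  "('k, 'm) ring_scheme \<Rightarrow> 'd digroup \<Rightarrow> ('k, 'a, 'd) rep \<Rightarrow> ('k, 'b, 'd) rep \<Rightarrow> ('a \<Rightarrow> 'b) set"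
where
  "rep_hom K D V W = {f \<in> lin_hom K V W.
     \<forall>x\<in>elems D. \<forall>v\<in>carrier V. f (lam V x v) = lam W x (f v) \<and> f (rho V x v) = rho W x (f v)}"


section \<open>Yoneda extensions\<close>

text \<open>
  An extension is a triple \<open>(V, i, p)\<close> standing for the sequence
  \<open>0 \<rightarrow> W \<rightarrow> V \<rightarrow> Q \<rightarrow> 0\<close>.
  The middle terms range over the representations whose carrier is a subset of the type \<open>'v\<close>.
  As every middle term is equipotent to \<open>carrier W \<times> carrier Q\<close>, all extensions are
  represented up to equivalence as soon as that product injects into \<open>'v\<close>; so
  \<open>Ext1\<close> is only meaningful under this condition on \<open>'v\<close>.
\<close>

type_synonym ('k, 'q, 'w, 'v, 'd) ext = "('k, 'v, 'd) rep \<times> ('w \<Rightarrow> 'v) \<times> ('v \<Rightarrow> 'q)"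

definition short_exact ::
  "('k, 'm) ring_scheme \<Rightarrow> 'd digroup \<Rightarrow> ('k, 'q, 'd) rep \<Rightarrow> ('k, 'w, 'd) rep
    \<Rightarrow> ('k, 'q, 'w, 'v, 'd) ext set"
where
  "short_exact K D Q W = {(V, i, p).
     digroup_rep K D V \<and> i \<in> rep_hom K D W V \<and> p \<in> rep_hom K D V Q \<and>
     inj_on i (carrier W) \<and> i ` carrier W = {v \<in> carrier V. p v = \<zero>\<^bsub>Q\<^esub>} \<and>
     p ` carrier V = carrier Q}"

definition ext_equiv ::
  "('k, 'm) ring_scheme \<Rightarrow> 'd digroup \<Rightarrow> ('k, 'q, 'd) rep \<Rightarrow> ('k, 'w, 'd) rep
    \<Rightarrow> ('k, 'q, 'w, 'v, 'd) ext rel"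
where
  "ext_equiv K D Q W = {((V, i, p), (V', i', p')).
     (V, i, p) \<in> short_exact K D Q W \<and> (V', i', p') \<in> short_exact K D Q W \<and>
     (\<exists>f\<in>rep_hom K D V V'. bij_betw f (carrier V) (carrier V') \<and>
        (\<forall>w\<in>carrier W. f (i w) = i' w) \<and> (\<forall>v\<in>carrier V. p' (f v) = p v))}"

definition Ext1 ::
  "('k, 'm) ring_scheme \<Rightarrow> 'd digroup \<Rightarrow> ('k, 'q, 'd) rep \<Rightarrow> ('k, 'w, 'd) rep
    \<Rightarrow> ('k, 'q, 'w, 'v, 'd) ext set set"
where
  "Ext1 K D Q W = short_exact K D Q W // ext_equiv K D Q W"

definition splits ::
  "('k, 'm) ring_scheme \<Rightarrow> 'd digroup \<Rightarrow> ('k, 'q, 'd) rep \<Rightarrow> ('k, 'q, 'w, 'v, 'd) ext \<Rightarrow> bool"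
where
  "splits K D Q = (\<lambda>(V, i, p). \<exists>s\<in>rep_hom K D Q V. \<forall>q\<in>carrier Q. p (s q) = q)"


section \<open>Cocycles and coboundaries\<close>

text \<open>
  The space \<open>Z\<^sup>1(Q, W)\<close>.  The multiplicative components of the record are never used.
\<close>

definition cocycles ::
  "('k, 'm) ring_scheme \<Rightarrow> 'd digroup \<Rightarrow> ('k, 'q, 'd) rep \<Rightarrow> ('k, 'w, 'd) rep
    \<Rightarrow> ('k, 'd \<Rightarrow> 'q \<Rightarrow> 'w) module"
where
  "cocycles K D Q W =
     \<lparr>carrier = {\<theta> \<in> elems D \<rightarrow>\<^sub>E (lin_hom K Q W \<inter> extensional (carrier Q)).
        \<forall>x\<in>elems D. \<forall>y\<in>elems D. \<forall>q\<in>carrier Q.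
          \<theta> (dashv D x y) q = lam W x (\<theta> y q) \<oplus>\<^bsub>W\<^esub> \<theta> x (lam Q y q) \<and>
          \<theta> (vdash D x y) q = rho W x (\<theta> y q) \<and>
          \<theta> (dashv D x y) q = \<theta> x (rho Q y q)},
      monoid.mult = undefined,
      one = undefined,
      zero = (\<lambda>x\<in>elems D. \<lambda>q\<in>carrier Q. \<zero>\<^bsub>W\<^esub>),
      add = (\<lambda>\<theta> \<theta>'. \<lambda>x\<in>elems D. \<lambda>q\<in>carrier Q. \<theta> x q \<oplus>\<^bsub>W\<^esub> \<theta>' x q),
      smult = (\<lambda>c \<theta>. \<lambda>x\<in>elems D. \<lambda>q\<in>carrier Q. c \<odot>\<^bsub>W\<^esub> \<theta> x q)\<rparr>"

text \<open>
  For the digroup of a group action on a nonempty set, \<open>\<rho>\<close> depends only on the group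
  component, so commuting with all \<open>\<rho>\<^sub>g\<close> is commuting with \<open>\<rho>\<^sub>x\<close> for
  all \<open>x = (g, \<alpha>)\<close>.
\<close>

definition Hom_rho ::
  "('k, 'm) ring_scheme \<Rightarrow> 'd digroup \<Rightarrow> ('k, 'q, 'd) rep \<Rightarrow> ('k, 'w, 'd) rep \<Rightarrow> ('q \<Rightarrow> 'w) set"
where
  "Hom_rho K D Q W = {t \<in> lin_hom K Q W \<inter> extensional (carrier Q).
     \<forall>x\<in>elems D. \<forall>q\<in>carrier Q. rho W x (t q) = t (rho Q x q)}"

definition delta ::
  "'d digroup \<Rightarrow> ('k, 'q, 'd) rep \<Rightarrow> ('k, 'w, 'd) rep \<Rightarrow> ('q \<Rightarrow> 'w) \<Rightarrow> 'd \<Rightarrow> 'q \<Rightarrow> 'w"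
where
  "delta D Q W t = (\<lambda>x\<in>elems D. \<lambda>q\<in>carrier Q. lam W x (t q) \<ominus>\<^bsub>W\<^esub> t (lam Q x q))"

definition coboundaries ::
  "('k, 'm) ring_scheme \<Rightarrow> 'd digroup \<Rightarrow> ('k, 'q, 'd) rep \<Rightarrow> ('k, 'w, 'd) rep
    \<Rightarrow> ('d \<Rightarrow> 'q \<Rightarrow> 'w) set"
where
  "coboundaries K D Q W = delta D Q W ` Hom_rho K D Q W"

end

theory Submission
  imports Defs
begin

text \<open>
  Let \<open>0 \<rightarrow> W \<rightarrow> V \<rightarrow> Q \<rightarrow> 0\<close> be an extension with maps \<open>i\<close> and \<open>p\<close>.  On the \<open>\<rho>\<close>-side a
  representation of the digroup is just a linear representation of the finite group \<open>G\<close>, so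
  averaging a linear section of \<open>p\<close> over \<open>G\<close> (characteristic zero) gives a linear section \<open>s\<close>
  that commutes with all \<open>\<rho>\<^sub>x\<close> (\<open>ex_equivariant_section\<close>).  What may fail is that \<open>s\<close> commutes
  with \<open>\<lambda>\<close>.  The failure \<open>\<lambda>\<^sub>x s - s \<lambda>\<^sub>x\<close> is the formal coboundary \<open>\<delta>s\<close>, taken in
  \<open>V\<close>; it is killed by \<open>p\<close>, hence equals \<open>i \<theta>\<^sub>x\<close> for a unique family \<open>\<theta>\<close> of maps from
  \<open>Q\<close> to \<open>W\<close>, and \<open>\<theta>\<close> inherits the cocycle identities from \<open>\<delta>s\<close> because \<open>i\<close> is injective.

  Two equivariant sections differ by \<open>i t\<close> with \<open>t\<close> in \<open>Hom\<^sub>\<rho>(Q, W)\<close>, and their cocycles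
  differ by \<open>\<delta>t\<close>.  So the cocycles obtained from all equivariant sections of one extension form
  exactly one coset of the coboundaries (\<open>section_cocycles_coset\<close>).  The bijection sends the class of
  an extension to this coset:

  \<^item> An isomorphism of extensions carries equivariant sections to equivariant sections with the
    same cocycle (\<open>section_cocycles_ext_equiv\<close>).  Cosets that share an element are equal, so
    equivalent extensions have the same coset.

  \<^item> If \<open>s\<close> has the cocycle \<open>\<theta>\<close>, then \<open>(w, q) \<mapsto> i w + s q\<close> identifies \<open>V\<close> with \<open>W \<times> Q\<close> carrying
    \<open>\<lambda>\<^sub>x(w, q) = (\<lambda>\<^sub>x w + \<theta>\<^sub>x q, \<lambda>\<^sub>x q)\<close> and \<open>\<rho>\<^sub>x(w, q) = (\<rho>\<^sub>x w, \<rho>\<^sub>x q)\<close>.  This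
    depends only on \<open>\<theta>\<close>, so extensions with a common cocycle are equivalent
    (\<open>ext_equivI\<close>).

  \<^item> For every cocycle these formulas do define a representation, which gives surjectivity
    (\<open>twisted_sum.realizes_cocycle\<close>).

  \<^item> An extension splits when some equivariant section has the cocycle \<open>0\<close>
    (\<open>splits_iff_zero_section_cocycle\<close>), that is, when its coset is that of the coboundaries.
\<close>

section \<open>Linear maps between modules with explicit carriers\<close>

context abelian_group
begin

lemma minus_eq_zero_iff [simp]:
  assumes "x \<in> carrier G" "y \<in> carrier G"
  shows "x \<ominus> y = \<zero> \<longleftrightarrow> x = y"
proof
  assume "x \<ominus> y = \<zero>"
  then show "x = y"
    using assms minus_equality[of x "\<ominus> y"] by (simp add: a_minus_def)
qed (use assms in \<open>simp add: a_minus_def r_neg\<close>)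

lemma minus_eqI:
  assumes "y \<in> carrier G" "z \<in> carrier G" "x = z \<oplus> y"
  shows "x \<ominus> y = z"
  using assms by (simp add: a_minus_def a_assoc r_neg)

lemma cancel_sandwich:
  assumes "x \<in> carrier G" "y \<in> carrier G"
  shows "x \<oplus> (y \<oplus> \<ominus> x) = y" "\<ominus> x \<oplus> (y \<oplus> x) = y"
  using assms by (simp_all add: a_comm[of y] r_neg1 r_neg2)

text \<open>
  Associativity and commutativity put all summands in a fixed order, in which a pair of opposite terms may end
  up with one term between them; the rules of \<open>cancel_sandwich\<close> remove such pairs.
\<close>

lemmas group_normalize = cancel_sandwich
  a_minus_def minus_add minus_minus a_assoc a_comm a_lcomm l_neg r_neg r_neg1 r_neg2

end

lemma lin_hom_closed [simp]: "f \<in> lin_hom K V W \<Longrightarrow> v \<in> carrier V \<Longrightarrow> f v \<in> carrier W"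
  by (auto simp: lin_hom_def)

lemma lin_hom_add:
  "f \<in> lin_hom K V W \<Longrightarrow> u \<in> carrier V \<Longrightarrow> v \<in> carrier V \<Longrightarrow> f (u \<oplus>\<^bsub>V\<^esub> v) = f u \<oplus>\<^bsub>W\<^esub> f v"
  unfolding lin_hom_def by blast

lemma lin_hom_smult:
  "f \<in> lin_hom K V W \<Longrightarrow> c \<in> carrier K \<Longrightarrow> v \<in> carrier V \<Longrightarrow> f (c \<odot>\<^bsub>V\<^esub> v) = c \<odot>\<^bsub>W\<^esub> f v"
  unfolding lin_hom_def by blast

lemma lin_homI:
  assumes "\<And>v. v \<in> carrier V \<Longrightarrow> f v \<in> carrier W"
    and "\<And>u v. u \<in> carrier V \<Longrightarrow> v \<in> carrier V \<Longrightarrow> f (u \<oplus>\<^bsub>V\<^esub> v) = f u \<oplus>\<^bsub>W\<^esub> f v"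
    and "\<And>c v. c \<in> carrier K \<Longrightarrow> v \<in> carrier V \<Longrightarrow> f (c \<odot>\<^bsub>V\<^esub> v) = c \<odot>\<^bsub>W\<^esub> f v"
  shows "f \<in> lin_hom K V W"
  using assms unfolding lin_hom_def by blast

lemma lin_hom_zero:
  assumes "module K V" "module K W" "f \<in> lin_hom K V W"
  shows "f \<zero>\<^bsub>V\<^esub> = \<zero>\<^bsub>W\<^esub>"
proof -
  interpret V: module K V by fact
  interpret W: module K W by fact
  have "f \<zero>\<^bsub>V\<^esub> \<oplus>\<^bsub>W\<^esub> f \<zero>\<^bsub>V\<^esub> = f \<zero>\<^bsub>V\<^esub>"
    using lin_hom_add[OF assms(3), of "\<zero>\<^bsub>V\<^esub>" "\<zero>\<^bsub>V\<^esub>"] by simp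
  then show ?thesis
    using assms(3) by simp
qed

lemma lin_hom_a_inv:
  assumes "module K V" "module K W" "f \<in> lin_hom K V W" "v \<in> carrier V"
  shows "f (\<ominus>\<^bsub>V\<^esub> v) = \<ominus>\<^bsub>W\<^esub> f v"
proof -
  interpret V: module K V by fact
  interpret W: module K W by fact
  have "f (\<ominus>\<^bsub>V\<^esub> v) \<oplus>\<^bsub>W\<^esub> f v = \<zero>\<^bsub>W\<^esub>"
    using lin_hom_add[OF assms(3), of "\<ominus>\<^bsub>V\<^esub> v" v] lin_hom_zero[OF assms(1-3)] assms(4)
    by (simp add: V.l_neg)
  then show ?thesis
    using assms by (simp add: W.minus_equality)
qed

lemma lin_hom_minus:
  assumes "module K V" "module K W" "f \<in> lin_hom K V W" "u \<in> carrier V" "v \<in> carrier V"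
  shows "f (u \<ominus>\<^bsub>V\<^esub> v) = f u \<ominus>\<^bsub>W\<^esub> f v"
proof -
  interpret V: module K V by fact
  show ?thesis
    using assms by (simp add: a_minus_def lin_hom_add lin_hom_a_inv)
qed

lemma lin_hom_finsum:
  assumes "module K V" "module K W" "f \<in> lin_hom K V W" "finite A" "h \<in> A \<rightarrow> carrier V"
  shows "f (\<Oplus>\<^bsub>V\<^esub>a\<in>A. h a) = (\<Oplus>\<^bsub>W\<^esub>a\<in>A. f (h a))"
proof -
  interpret V: module K V by fact
  interpret W: module K W by fact
  show ?thesis
    using assms(4,5)
  proof (induction rule: finite_induct)
    case empty
    then show ?case by (simp add: lin_hom_zero[OF assms(1-3)])
  next
    case (insert a A)
    then have "h a \<in> carrier V" "h \<in> A \<rightarrow> carrier V" "(\<lambda>a. f (h a)) \<in> A \<rightarrow> carrier W"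
      using assms(3) by (auto simp: Pi_iff)
    then show ?case
      using insert assms(3) by (simp add: lin_hom_add)
  qed
qed

lemma lin_hom_restrict:
  assumes "module K V" "f \<in> lin_hom K V W"
  shows "restrict f (carrier V) \<in> lin_hom K V W"
proof -
  interpret V: module K V by fact
  show ?thesis
    using assms(2) by (intro lin_homI) (auto simp: lin_hom_add lin_hom_smult)
qed

lemma (in module) finsum_const_smult:
  assumes "finite A" "v \<in> carrier M"
  shows "(\<Oplus>\<^bsub>M\<^esub>a\<in>A. v) = ([card A] \<cdot>\<^bsub>R\<^esub> \<one>\<^bsub>R\<^esub>) \<odot>\<^bsub>M\<^esub> v"
  using assms(1)
proof (induction rule: finite_induct)
  case empty
  then show ?case using assms(2) by simp
next
  case (insert a A)
  have one: "([card A] \<cdot>\<^bsub>R\<^esub> \<one>\<^bsub>R\<^esub>) \<in> carrier R"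
    by simp
  have "(\<Oplus>\<^bsub>M\<^esub>a\<in>insert a A. v) = v \<oplus>\<^bsub>M\<^esub> ([card A] \<cdot>\<^bsub>R\<^esub> \<one>\<^bsub>R\<^esub>) \<odot>\<^bsub>M\<^esub> v"
    using insert assms(2) by simp
  also have "\<dots> = ([Suc (card A)] \<cdot>\<^bsub>R\<^esub> \<one>\<^bsub>R\<^esub>) \<odot>\<^bsub>M\<^esub> v"
    using one assms(2) by (simp add: smult_l_distr M.a_comm)
  finally show ?case
    using insert by simp
qed

section \<open>Linear sections of surjective linear maps\<close>

text \<open>
  A subspace \<open>S\<close> that is maximal among those meeting the kernel of \<open>p\<close> trivially is a complement of
  the kernel: if \<open>p v\<close> were outside \<open>p S\<close>, then \<open>S + K v\<close> would still meet the kernel trivially.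
  So \<open>p\<close> maps \<open>S\<close> bijectively onto \<open>Q\<close>, and the inverse of this restriction is the section.
  Zorn's lemma makes this work in infinite dimension.
\<close>

lemma ex_linear_section:
  assumes K: "field K" and V: "module K V" and Q: "module K Q"
    and p: "p \<in> lin_hom K V Q" and surj: "p ` carrier V = carrier Q"
  shows "\<exists>s\<in>lin_hom K Q V. \<forall>q\<in>carrier Q. p (s q) = q"
proof -
  interpret K: field K by fact
  interpret V: module K V by fact
  interpret Q: module K Q by fact
  define \<S> where "\<S> = {S. submodule S K V \<and> (\<forall>v\<in>S. p v = \<zero>\<^bsub>Q\<^esub> \<longrightarrow> v = \<zero>\<^bsub>V\<^esub>)}"
  have sub: "S \<subseteq> carrier V" "\<zero>\<^bsub>V\<^esub> \<in> S" "\<And>v. v \<in> S \<Longrightarrow> \<ominus>\<^bsub>V\<^esub> v \<in> S"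
      "\<And>c v. c \<in> carrier K \<Longrightarrow> v \<in> S \<Longrightarrow> c \<odot>\<^bsub>V\<^esub> v \<in> S"
      "\<And>u v. u \<in> S \<Longrightarrow> v \<in> S \<Longrightarrow> u \<oplus>\<^bsub>V\<^esub> v \<in> S"
      "\<And>v. v \<in> S \<Longrightarrow> p v = \<zero>\<^bsub>Q\<^esub> \<Longrightarrow> v = \<zero>\<^bsub>V\<^esub>"
    if "S \<in> \<S>" for S
  proof -
    have S: "submodule S K V" using that by (simp add: \<S>_def)
    show "S \<subseteq> carrier V" "\<And>v. v \<in> S \<Longrightarrow> \<ominus>\<^bsub>V\<^esub> v \<in> S"
      "\<And>c v. c \<in> carrier K \<Longrightarrow> v \<in> S \<Longrightarrow> c \<odot>\<^bsub>V\<^esub> v \<in> S"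
      "\<And>u v. u \<in> S \<Longrightarrow> v \<in> S \<Longrightarrow> u \<oplus>\<^bsub>V\<^esub> v \<in> S"
      using V.submoduleE[OF S] by blast+
    show "\<zero>\<^bsub>V\<^esub> \<in> S"
      using subgroup.one_closed[OF submodule.axioms(1)[OF S]] by simp
    show "\<And>v. v \<in> S \<Longrightarrow> p v = \<zero>\<^bsub>Q\<^esub> \<Longrightarrow> v = \<zero>\<^bsub>V\<^esub>"
      using that by (simp add: \<S>_def)
  qed
  have "\<exists>S\<in>\<S>. \<forall>T\<in>\<S>. S \<subseteq> T \<longrightarrow> T = S"
  proof (rule subset_Zorn_nonempty)
    have "submodule {\<zero>\<^bsub>V\<^esub>} K V"
      by (rule V.submoduleI) auto
    then show "\<S> \<noteq> {}"
      unfolding \<S>_def by blast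
  next
    fix C assume "C \<noteq> {}" and C: "subset.chain \<S> C"
    then have sub': "S \<in> \<S>" if "S \<in> C" for S
      using that by (auto simp: subset_chain_def)
    have dir: "\<exists>S\<in>C. u \<in> S \<and> v \<in> S" if "u \<in> \<Union>C" "v \<in> \<Union>C" for u v
      using that C unfolding subset_chain_def by blast
    have "submodule (\<Union>C) K V"
    proof (rule V.submoduleI)
      show "\<Union>C \<subseteq> carrier V" using sub(1) sub' by blast
      show "\<zero>\<^bsub>V\<^esub> \<in> \<Union>C" using \<open>C \<noteq> {}\<close> sub(2) sub' by blast
      show "\<And>v. v \<in> \<Union>C \<Longrightarrow> \<ominus>\<^bsub>V\<^esub> v \<in> \<Union>C" using sub(3) sub' by blast
      show "u \<oplus>\<^bsub>V\<^esub> v \<in> \<Union>C" if "u \<in> \<Union>C" "v \<in> \<Union>C" for u v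
        using dir[OF that] sub(5) sub' by blast
      show "\<And>c v. c \<in> carrier K \<Longrightarrow> v \<in> \<Union>C \<Longrightarrow> c \<odot>\<^bsub>V\<^esub> v \<in> \<Union>C" using sub(4) sub' by blast
    qed
    then show "\<Union>C \<in> \<S>"
      unfolding \<S>_def using sub(6) sub' by blast
  qed
  then obtain S where S: "S \<in> \<S>" and maximal: "\<And>T. T \<in> \<S> \<Longrightarrow> S \<subseteq> T \<Longrightarrow> T = S"
    by blast
  note [simp] = subsetD[OF sub(1)[OF S]]
  have unique: "u = v" if uv: "u \<in> S" "v \<in> S" "p u = p v" for u v
  proof -
    have "p (u \<ominus>\<^bsub>V\<^esub> v) = \<zero>\<^bsub>Q\<^esub>"
      using that p by (simp add: lin_hom_minus[OF V Q p])
    moreover have "u \<ominus>\<^bsub>V\<^esub> v \<in> S"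
      using that sub(3,5)[OF S] by (simp add: a_minus_def)
    ultimately have "u \<ominus>\<^bsub>V\<^esub> v = \<zero>\<^bsub>V\<^esub>"
      using sub(6)[OF S] by blast
    then show ?thesis
      using that by simp
  qed
  have exists: "\<exists>u\<in>S. p u = q" if q: "q \<in> carrier Q" for q
  proof (rule ccontr)
    assume none: "\<not> ?thesis"
    have "q \<in> p ` carrier V"
      using q surj by simp
    then obtain v where v: "v \<in> carrier V" "p v = q"
      by auto
    define T where "T = {u \<oplus>\<^bsub>V\<^esub> c \<odot>\<^bsub>V\<^esub> v | u c. u \<in> S \<and> c \<in> carrier K}"
    have "submodule T K V"
    proof (rule V.submoduleI)
      show "T \<subseteq> carrier V" using v by (auto simp: T_def)
      show "\<zero>\<^bsub>V\<^esub> \<in> T"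
        unfolding T_def using v sub(2)[OF S]
        by (intro CollectI exI[of _ "\<zero>\<^bsub>V\<^esub>"] exI[of _ "\<zero>\<^bsub>K\<^esub>"]) simp
    next
      fix a assume "a \<in> T"
      then obtain u c where "a = u \<oplus>\<^bsub>V\<^esub> c \<odot>\<^bsub>V\<^esub> v" "u \<in> S" "c \<in> carrier K"
        by (auto simp: T_def)
      then show "\<ominus>\<^bsub>V\<^esub> a \<in> T"
        unfolding T_def using v sub(3)[OF S]
        by (intro CollectI exI[of _ "\<ominus>\<^bsub>V\<^esub> u"] exI[of _ "\<ominus>\<^bsub>K\<^esub> c"])
          (simp add: V.minus_add V.smult_l_minus V.a_comm)
    next
      fix a b assume "a \<in> T" "b \<in> T"
      then obtain u c u' c' where "a = u \<oplus>\<^bsub>V\<^esub> c \<odot>\<^bsub>V\<^esub> v" "u \<in> S" "c \<in> carrier K"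
        "b = u' \<oplus>\<^bsub>V\<^esub> c' \<odot>\<^bsub>V\<^esub> v" "u' \<in> S" "c' \<in> carrier K"
        unfolding T_def by blast
      then show "a \<oplus>\<^bsub>V\<^esub> b \<in> T"
        unfolding T_def using v sub(5)[OF S]
        by (intro CollectI exI[of _ "u \<oplus>\<^bsub>V\<^esub> u'"] exI[of _ "c \<oplus>\<^bsub>K\<^esub> c'"])
          (simp add: V.smult_l_distr V.a_ac)
    next
      fix k a assume "k \<in> carrier K" "a \<in> T"
      then obtain u c where "a = u \<oplus>\<^bsub>V\<^esub> c \<odot>\<^bsub>V\<^esub> v" "u \<in> S" "c \<in> carrier K"
        by (auto simp: T_def)
      then show "k \<odot>\<^bsub>V\<^esub> a \<in> T"
        unfolding T_def using v \<open>k \<in> carrier K\<close> sub(4)[OF S]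
        by (intro CollectI exI[of _ "k \<odot>\<^bsub>V\<^esub> u"] exI[of _ "k \<otimes>\<^bsub>K\<^esub> c"])
          (simp add: V.smult_r_distr V.smult_assoc1)
    qed
    moreover have "a = \<zero>\<^bsub>V\<^esub>" if a: "a \<in> T" "p a = \<zero>\<^bsub>Q\<^esub>" for a
    proof -
      obtain u c where uc: "a = u \<oplus>\<^bsub>V\<^esub> c \<odot>\<^bsub>V\<^esub> v" "u \<in> S" "c \<in> carrier K"
        using a by (auto simp: T_def)
      have eq: "p u \<oplus>\<^bsub>Q\<^esub> c \<odot>\<^bsub>Q\<^esub> q = \<zero>\<^bsub>Q\<^esub>"
        using a(2) uc v p by (simp add: lin_hom_add lin_hom_smult)
      show ?thesis
      proof (cases "c = \<zero>\<^bsub>K\<^esub>")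
        case True
        then show ?thesis
          using eq uc v q p sub(6)[OF S, of u] by simp
      next
        case False
        then have c: "inv\<^bsub>K\<^esub> c \<in> carrier K" "inv\<^bsub>K\<^esub> c \<otimes>\<^bsub>K\<^esub> c = \<one>\<^bsub>K\<^esub>"
          using uc(3) K.field_Units by auto
        \<comment> \<open>Dividing by the nonzero coefficient exhibits \<open>q\<close> as the image of \<open>- u / c\<close>, an element of \<open>S\<close>.\<close>
        have "c \<odot>\<^bsub>Q\<^esub> q = \<ominus>\<^bsub>Q\<^esub> p u"
          using eq uc q p by (simp add: Q.minus_equality Q.a_comm[of "p u"])
        then have "inv\<^bsub>K\<^esub> c \<odot>\<^bsub>Q\<^esub> (c \<odot>\<^bsub>Q\<^esub> q) = p (inv\<^bsub>K\<^esub> c \<odot>\<^bsub>V\<^esub> (\<ominus>\<^bsub>V\<^esub> u))"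
          using uc c p by (simp add: lin_hom_smult lin_hom_a_inv[OF V Q])
        then have "p (inv\<^bsub>K\<^esub> c \<odot>\<^bsub>V\<^esub> (\<ominus>\<^bsub>V\<^esub> u)) = q"
          using c uc q by (simp flip: Q.smult_assoc1)
        then show ?thesis
          using none c uc sub(3,4)[OF S] by blast
      qed
    qed
    ultimately have "T \<in> \<S>"
      by (simp add: \<S>_def)
    moreover have "S \<subseteq> T"
    proof
      fix u assume "u \<in> S"
      then show "u \<in> T"
        unfolding T_def using v by (intro CollectI exI[of _ u] exI[of _ "\<zero>\<^bsub>K\<^esub>"]) simp
    qed
    moreover have "v \<in> T"
      unfolding T_def using v sub(2)[OF S]
      by (intro CollectI exI[of _ "\<zero>\<^bsub>V\<^esub>"] exI[of _ "\<one>\<^bsub>K\<^esub>"]) simp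
    ultimately have "v \<in> S"
      using maximal by blast
    then show False
      using none v by blast
  qed
  define s where "s q = (SOME u. u \<in> S \<and> p u = q)" for q
  have s: "s q \<in> S" "p (s q) = q" if "q \<in> carrier Q" for q
    using someI_ex[of "\<lambda>u. u \<in> S \<and> p u = q"] exists[OF that] by (auto simp: s_def)
  have "s \<in> lin_hom K Q V"
  proof (rule lin_homI)
    show "s q \<in> carrier V" if "q \<in> carrier Q" for q
      using s that by simp
    show "s (q \<oplus>\<^bsub>Q\<^esub> r) = s q \<oplus>\<^bsub>V\<^esub> s r" if "q \<in> carrier Q" "r \<in> carrier Q" for q r
      using that s sub(5)[OF S] p by (intro unique) (auto simp: lin_hom_add)
    show "s (c \<odot>\<^bsub>Q\<^esub> q) = c \<odot>\<^bsub>V\<^esub> s q" if "c \<in> carrier K" "q \<in> carrier Q" for c q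
      using that s sub(4)[OF S] p by (intro unique) (auto simp: lin_hom_smult)
  qed
  then show ?thesis
    using s by blast
qed

section \<open>Equivariant sections by averaging\<close>

sublocale digroup_rep \<subseteq> module K V
  by (rule vector_space)

context digroup_rep
begin

lemma lam_closed [simp]: "x \<in> elems D \<Longrightarrow> v \<in> carrier V \<Longrightarrow> lam V x v \<in> carrier V"
  by (rule lin_hom_closed[OF lam_End])

lemma rho_closed [simp]: "x \<in> elems D \<Longrightarrow> v \<in> carrier V \<Longrightarrow> rho V x v \<in> carrier V"
  by (rule lin_hom_closed[OF rho_End])

lemmas lam_add = lin_hom_add[OF lam_End]
lemmas lam_smult = lin_hom_smult[OF lam_End]
lemmas lam_a_inv = lin_hom_a_inv[OF vector_space vector_space lam_End]
lemmas rho_add = lin_hom_add[OF rho_End]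
lemmas rho_smult = lin_hom_smult[OF rho_End]
lemmas rho_minus = lin_hom_minus[OF vector_space vector_space rho_End]

end

definition equivariant_sections ::
  "('k, 'm) ring_scheme \<Rightarrow> 'd digroup \<Rightarrow> ('k, 'q, 'd) rep \<Rightarrow> ('k, 'v, 'd) rep
    \<Rightarrow> ('v \<Rightarrow> 'q) \<Rightarrow> ('q \<Rightarrow> 'v) set"
where
  "equivariant_sections K D Q V p = {s \<in> Hom_rho K D Q V. \<forall>q\<in>carrier Q. p (s q) = q}"

text \<open>
  Since \<open>(g, \<beta>) \<turnstile> (1, \<gamma>) = (g, g \<bullet> \<gamma>)\<close> and \<open>\<rho>\<close> is trivial on the halo, \<open>\<rho>\<close> takes the same
  value at \<open>(g, \<beta>)\<close> and at \<open>(g, g \<bullet> \<gamma>)\<close>; as \<open>g\<close> permutes \<open>E\<close>, it depends on \<open>g\<close> alone.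
  The three points \<open>\<alpha>, \<beta>, \<gamma>\<close> are therefore independent of one another, and \<open>\<rho>\<close> is a
  representation of \<open>G\<close>.
\<close>

lemma rho_action_digroup:
  assumes act: "group_action G E \<phi>" and V: "digroup_rep K (action_digroup G E \<phi>) V"
    and g: "g \<in> carrier G" and h: "h \<in> carrier G"
    and E: "\<alpha> \<in> E" "\<beta> \<in> E" "\<gamma> \<in> E" and v: "v \<in> carrier V"
  shows "rho V (g, \<alpha>) (rho V (h, \<beta>) v) = rho V (g \<otimes>\<^bsub>G\<^esub> h, \<gamma>) v"
proof -
  interpret group_action G E \<phi> by fact
  interpret group G
    using group_hom group_hom.axioms(1) by blast
  interpret V: digroup_rep K "action_digroup G E \<phi>" V by fact
  have indep: "rho V (k, \<mu>) v = rho V (k, \<nu>) v" if "k \<in> carrier G" "\<mu> \<in> E" "\<nu> \<in> E" for k \<mu> \<nu>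
  proof -
    have "\<mu> \<in> \<phi> k ` E"
      using that by (simp add: surj_prop)
    then obtain \<mu>' where \<mu>': "\<mu>' \<in> E" "\<phi> k \<mu>' = \<mu>"
      by auto
    have "rho V (vdash (action_digroup G E \<phi>) (k, \<nu>) (\<one>\<^bsub>G\<^esub>, \<mu>')) v
        = rho V (k, \<nu>) (rho V (\<one>\<^bsub>G\<^esub>, \<mu>') v)"
      using that \<mu>' v by (intro V.rho_vdash) (auto simp: action_digroup_def)
    moreover have "rho V (\<one>\<^bsub>G\<^esub>, \<mu>') v = v"
      using \<mu>' v by (intro V.rho_halo) (auto simp: action_digroup_def)
    ultimately show ?thesis
      using that \<mu>' by (simp add: action_digroup_def)
  qed
  have "rho V (vdash (action_digroup G E \<phi>) (g, \<alpha>) (h, \<beta>)) v = rho V (g, \<alpha>) (rho V (h, \<beta>) v)"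
    using assms by (intro V.rho_vdash) (auto simp: action_digroup_def)
  then have "rho V (g, \<alpha>) (rho V (h, \<beta>) v) = rho V (g \<otimes>\<^bsub>G\<^esub> h, \<phi> g \<beta>) v"
    by (simp add: action_digroup_def)
  also have "\<dots> = rho V (g \<otimes>\<^bsub>G\<^esub> h, \<gamma>) v"
    using g h E(3) element_image[OF g E(2) refl] by (intro indep) auto
  finally show ?thesis .
qed

text \<open>
  This is Maschke's averaging argument.  The mean of the conjugates \<open>\<rho>\<^sub>g s \<rho>\<^sub>g\<^sup>-\<^sup>1\<close> of a
  linear section is equivariant by reindexing the sum, and it is again a section because every conjugate is.
\<close>

lemma ex_equivariant_section:
  assumes K: "field K"
    and char_0: "\<forall>n::nat. 0 < n \<longrightarrow> [n] \<cdot>\<^bsub>K\<^esub> \<one>\<^bsub>K\<^esub> \<noteq> \<zero>\<^bsub>K\<^esub>"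
    and fin: "finite (carrier G)"
    and act: "group_action G E \<phi>" "E \<noteq> {}"
    and D: "D = action_digroup G E \<phi>"
    and Q: "digroup_rep K D Q" and V: "digroup_rep K D V"
    and p: "p \<in> rep_hom K D V Q" and surj: "p ` carrier V = carrier Q"
  shows "equivariant_sections K D Q V p \<noteq> {}"
proof -
  interpret group_action G E \<phi> by fact
  interpret group G
    using group_hom group_hom.axioms(1) by blast
  interpret K: field K by fact
  interpret Q: digroup_rep K D Q by fact
  interpret V: digroup_rep K D V by fact
  obtain \<alpha> where \<alpha>: "\<alpha> \<in> E"
    using act by blast
  have elems: "(g, \<beta>) \<in> elems D" if "g \<in> carrier G" "\<beta> \<in> E" for g \<beta>
    using that by (simp add: D action_digroup_def)
  have p': "p \<in> lin_hom K V Q" "\<And>x v. x \<in> elems D \<Longrightarrow> v \<in> carrier V \<Longrightarrow> p (rho V x v) = rho Q x (p v)"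
    using p by (auto simp: rep_hom_def)
  obtain s where s: "s \<in> lin_hom K Q V" "\<And>q. q \<in> carrier Q \<Longrightarrow> p (s q) = q"
    using ex_linear_section[OF K V.vector_space Q.vector_space p'(1) surj] by blast
  define n where "n = [card (carrier G)] \<cdot>\<^bsub>K\<^esub> \<one>\<^bsub>K\<^esub>"
  have "card (carrier G) > 0"
    using fin by (auto simp: card_gt_0_iff)
  then have "n \<in> Units K"
    using char_0 K.field_Units by (auto simp: n_def)
  then have n: "n \<in> carrier K" "inv\<^bsub>K\<^esub> n \<in> carrier K" "inv\<^bsub>K\<^esub> n \<otimes>\<^bsub>K\<^esub> n = \<one>\<^bsub>K\<^esub>"
    by auto
  \<comment> \<open>\<open>\<rho>\<close> depends only on the group component, so one base point \<open>\<alpha>\<close> serves for all of \<open>G\<close>.\<close>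
  define conj where "conj g q = rho V (g, \<alpha>) (s (rho Q (inv\<^bsub>G\<^esub> g, \<alpha>) q))" for g q
  define avg where "avg q = inv\<^bsub>K\<^esub> n \<odot>\<^bsub>V\<^esub> (\<Oplus>\<^bsub>V\<^esub>g\<in>carrier G. conj g q)" for q
  have conj: "conj g \<in> lin_hom K Q V" if "g \<in> carrier G" for g
    unfolding conj_def using that elems \<alpha> s(1)
    by (intro lin_homI)
      (auto simp: lin_hom_add lin_hom_smult Q.rho_add Q.rho_smult V.rho_add V.rho_smult)
  note [simp] = lin_hom_closed[OF conj]
  have conj_in: "(\<lambda>g. conj g q) \<in> carrier G \<rightarrow> carrier V" if "q \<in> carrier Q" for q
    using that by (intro Pi_I lin_hom_closed[OF conj])
  have avg: "avg \<in> lin_hom K Q V"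
  proof (rule lin_homI)
    show "avg q \<in> carrier V" if "q \<in> carrier Q" for q
      using that n conj_in by (simp add: avg_def)
  next
    fix q r assume qr: "q \<in> carrier Q" "r \<in> carrier Q"
    have "(\<Oplus>\<^bsub>V\<^esub>g\<in>carrier G. conj g (q \<oplus>\<^bsub>Q\<^esub> r)) = (\<Oplus>\<^bsub>V\<^esub>g\<in>carrier G. conj g q \<oplus>\<^bsub>V\<^esub> conj g r)"
      using qr by (intro V.finsum_cong') (auto simp: lin_hom_add[OF conj])
    then show "avg (q \<oplus>\<^bsub>Q\<^esub> r) = avg q \<oplus>\<^bsub>V\<^esub> avg r"
      using qr n conj_in by (simp add: avg_def V.finsum_addf V.smult_r_distr)
  next
    fix c q assume cq: "c \<in> carrier K" "q \<in> carrier Q"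
    have "(\<Oplus>\<^bsub>V\<^esub>g\<in>carrier G. conj g (c \<odot>\<^bsub>Q\<^esub> q)) = (\<Oplus>\<^bsub>V\<^esub>g\<in>carrier G. c \<odot>\<^bsub>V\<^esub> conj g q)"
      using cq by (intro V.finsum_cong') (auto simp: lin_hom_smult[OF conj])
    also have "\<dots> = c \<odot>\<^bsub>V\<^esub> (\<Oplus>\<^bsub>V\<^esub>g\<in>carrier G. conj g q)"
      using cq conj_in fin by (simp add: V.finsum_smult_ldistr)
    finally show "avg (c \<odot>\<^bsub>Q\<^esub> q) = c \<odot>\<^bsub>V\<^esub> avg q"
      using cq n conj_in by (simp add: avg_def K.m_comm flip: V.smult_assoc1)
  qed
  have p_conj: "p (conj g q) = q" if "g \<in> carrier G" "q \<in> carrier Q" for g q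
  proof -
    have "p (conj g q) = rho Q (g, \<alpha>) (rho Q (inv\<^bsub>G\<^esub> g, \<alpha>) q)"
      using that elems \<alpha> s by (simp add: conj_def p')
    also have "\<dots> = rho Q (\<one>\<^bsub>G\<^esub>, \<alpha>) q"
      using that \<alpha> rho_action_digroup[OF act(1) Q[unfolded D], of g "inv\<^bsub>G\<^esub> g" \<alpha> \<alpha> \<alpha> q] by simp
    also have "\<dots> = q"
      using that \<alpha> by (intro Q.rho_halo) (auto simp: D action_digroup_def)
    finally show ?thesis .
  qed
  have p_avg: "p (avg q) = q" if q: "q \<in> carrier Q" for q
  proof -
    have "p (avg q) = inv\<^bsub>K\<^esub> n \<odot>\<^bsub>Q\<^esub> (\<Oplus>\<^bsub>Q\<^esub>g\<in>carrier G. p (conj g q))"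
      using q n conj_in fin p'(1)
      by (simp add: avg_def lin_hom_smult lin_hom_finsum[OF V.vector_space Q.vector_space])
    also have "(\<Oplus>\<^bsub>Q\<^esub>g\<in>carrier G. p (conj g q)) = (\<Oplus>\<^bsub>Q\<^esub>g\<in>carrier G. q)"
      using q p_conj by (intro Q.finsum_cong') auto
    also have "\<dots> = n \<odot>\<^bsub>Q\<^esub> q"
      using q fin by (simp add: n_def Q.finsum_const_smult)
    finally show ?thesis
      using q n by (simp flip: Q.smult_assoc1)
  qed
  have equivariant: "rho V x (avg q) = avg (rho Q x q)" if x: "x \<in> elems D" and q: "q \<in> carrier Q" for x q
  proof -
    obtain h \<beta> where x': "x = (h, \<beta>)" "h \<in> carrier G" "\<beta> \<in> E"
      using x by (auto simp: D action_digroup_def)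
    have shift: "rho V x (conj g q) = conj (h \<otimes>\<^bsub>G\<^esub> g) (rho Q x q)" if g: "g \<in> carrier G" for g
    proof -
      have "rho V x (conj g q) = rho V (h \<otimes>\<^bsub>G\<^esub> g, \<alpha>) (s (rho Q (inv\<^bsub>G\<^esub> g, \<alpha>) q))"
        unfolding conj_def x' using g x' \<alpha> q s(1) elems
        by (intro rho_action_digroup[OF act(1) V[unfolded D]]) auto
      moreover have "rho Q (inv\<^bsub>G\<^esub> (h \<otimes>\<^bsub>G\<^esub> g), \<alpha>) (rho Q x q)
          = rho Q (inv\<^bsub>G\<^esub> (h \<otimes>\<^bsub>G\<^esub> g) \<otimes>\<^bsub>G\<^esub> h, \<alpha>) q"
        unfolding x' using g x' \<alpha> q
        by (intro rho_action_digroup[OF act(1) Q[unfolded D]]) auto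
      moreover have "inv\<^bsub>G\<^esub> (h \<otimes>\<^bsub>G\<^esub> g) \<otimes>\<^bsub>G\<^esub> h = inv\<^bsub>G\<^esub> g"
        using g x' by (simp add: inv_mult_group m_assoc)
      ultimately show ?thesis
        by (simp add: conj_def)
    qed
    have bij: "bij_betw (\<lambda>g. h \<otimes>\<^bsub>G\<^esub> g) (carrier G) (carrier G)"
      using x' by (intro bij_betw_byWitness[where f' = "\<lambda>g. inv\<^bsub>G\<^esub> h \<otimes>\<^bsub>G\<^esub> g"]) (auto simp flip: m_assoc)
    have "rho V x (avg q) = inv\<^bsub>K\<^esub> n \<odot>\<^bsub>V\<^esub> (\<Oplus>\<^bsub>V\<^esub>g\<in>carrier G. rho V x (conj g q))"
      using q n x conj_in fin
      by (simp add: avg_def V.rho_smult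
          lin_hom_finsum[OF V.vector_space V.vector_space V.rho_End[OF x]])
    also have "(\<Oplus>\<^bsub>V\<^esub>g\<in>carrier G. rho V x (conj g q))
        = (\<Oplus>\<^bsub>V\<^esub>g\<in>carrier G. conj (h \<otimes>\<^bsub>G\<^esub> g) (rho Q x q))"
      using x x' q shift conj_in[of "rho Q x q"] by (intro V.finsum_cong') auto
    also have "\<dots> = (\<Oplus>\<^bsub>V\<^esub>g\<in>carrier G. conj g (rho Q x q))"
      using V.finsum_reindex[of "\<lambda>g. conj g (rho Q x q)" "\<lambda>g. h \<otimes>\<^bsub>G\<^esub> g" "carrier G"]
        bij conj_in[of "rho Q x q"] x q by (simp add: bij_betw_def)
    finally show ?thesis
      by (simp add: avg_def)
  qed
  have "restrict avg (carrier Q) \<in> equivariant_sections K D Q V p"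
    using avg p_avg equivariant lin_hom_restrict[OF Q.vector_space avg]
    by (simp add: equivariant_sections_def Hom_rho_def)
  then show ?thesis
    by blast
qed

section \<open>Cocycles and formal coboundaries\<close>

text \<open>
  Families that are extensional in both arguments are determined by their values on the carriers.
  The coset of an extension is cut out from this larger space; that its members are cocycles is then a
  consequence (\<open>section_cocycles_subset\<close>).
\<close>

abbreviation families ::
  "'d digroup \<Rightarrow> ('k, 'q, 'd) rep \<Rightarrow> ('k, 'w, 'd) rep \<Rightarrow> ('d \<Rightarrow> 'q \<Rightarrow> 'w) set"
where
  "families D Q W \<equiv> elems D \<rightarrow>\<^sub>E (carrier Q \<rightarrow>\<^sub>E carrier W)"

lemma families_eqI:
  assumes "\<theta> \<in> families D Q W" "\<theta>' \<in> families D Q W"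
    and "\<And>x q. x \<in> elems D \<Longrightarrow> q \<in> carrier Q \<Longrightarrow> \<theta> x q = \<theta>' x q"
  shows "\<theta> = \<theta>'"
proof (rule PiE_ext[OF assms(1,2)])
  fix x assume x: "x \<in> elems D"
  show "\<theta> x = \<theta>' x"
    by (rule PiE_ext[OF PiE_mem[OF assms(1) x] PiE_mem[OF assms(2) x]]) (rule assms(3)[OF x])
qed

lemma families_closed:
  assumes "\<theta> \<in> families D Q W" "x \<in> elems D" "q \<in> carrier Q"
  shows "\<theta> x q \<in> carrier W"
  by (rule PiE_mem[OF PiE_mem[OF assms(1,2)] assms(3)])

lemma carrier_cocycles:
  "carrier (cocycles K D Q W) = {\<theta> \<in> elems D \<rightarrow>\<^sub>E (lin_hom K Q W \<inter> extensional (carrier Q)).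
     \<forall>x\<in>elems D. \<forall>y\<in>elems D. \<forall>q\<in>carrier Q.
       \<theta> (dashv D x y) q = lam W x (\<theta> y q) \<oplus>\<^bsub>W\<^esub> \<theta> x (lam Q y q) \<and>
       \<theta> (vdash D x y) q = rho W x (\<theta> y q) \<and>
       \<theta> (dashv D x y) q = \<theta> x (rho Q y q)}"
  by (simp only: cocycles_def partial_object.select_convs)

lemma cocyclesD:
  assumes "\<theta> \<in> carrier (cocycles K D Q W)"
  shows "\<theta> \<in> families D Q W"
    and "\<And>x. x \<in> elems D \<Longrightarrow> \<theta> x \<in> lin_hom K Q W"
    and "\<And>x y q. x \<in> elems D \<Longrightarrow> y \<in> elems D \<Longrightarrow> q \<in> carrier Q \<Longrightarrow>
      \<theta> (dashv D x y) q = lam W x (\<theta> y q) \<oplus>\<^bsub>W\<^esub> \<theta> x (lam Q y q)"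
    and "\<And>x y q. x \<in> elems D \<Longrightarrow> y \<in> elems D \<Longrightarrow> q \<in> carrier Q \<Longrightarrow>
      \<theta> (vdash D x y) q = rho W x (\<theta> y q)"
    and "\<And>x y q. x \<in> elems D \<Longrightarrow> y \<in> elems D \<Longrightarrow> q \<in> carrier Q \<Longrightarrow>
      \<theta> (dashv D x y) q = \<theta> x (rho Q y q)"
proof -
  note cocycle = CollectD[OF assms[unfolded carrier_cocycles]]
  have \<theta>: "\<theta> \<in> elems D \<rightarrow>\<^sub>E (lin_hom K Q W \<inter> extensional (carrier Q))"
    by (rule conjunct1[OF cocycle])
  note eqs = conjunct2[OF cocycle, rule_format]
  have lin: "\<theta> x \<in> lin_hom K Q W" "\<theta> x \<in> extensional (carrier Q)" if "x \<in> elems D" for x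
    using PiE_mem[OF \<theta> that] by simp_all
  show "\<theta> \<in> families D Q W"
  proof (rule PiE_I)
    fix x assume x: "x \<in> elems D"
    show "\<theta> x \<in> carrier Q \<rightarrow>\<^sub>E carrier W"
      by (simp add: PiE_iff lin_hom_closed[OF lin(1)[OF x]] lin(2)[OF x])
  qed (rule PiE_arb[OF \<theta>])
  show "\<theta> x \<in> lin_hom K Q W" if "x \<in> elems D" for x
    using that by (rule lin(1))
  show "\<theta> (dashv D x y) q = lam W x (\<theta> y q) \<oplus>\<^bsub>W\<^esub> \<theta> x (lam Q y q)"
    "\<theta> (vdash D x y) q = rho W x (\<theta> y q)" "\<theta> (dashv D x y) q = \<theta> x (rho Q y q)"
    if "x \<in> elems D" "y \<in> elems D" "q \<in> carrier Q" for x y q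
    by (insert eqs[OF that], elim conjE, assumption)+
qed

lemma cocyclesI:
  assumes "\<theta> \<in> families D Q W"
    and "\<And>x. x \<in> elems D \<Longrightarrow> \<theta> x \<in> lin_hom K Q W"
    and "\<And>x y q. x \<in> elems D \<Longrightarrow> y \<in> elems D \<Longrightarrow> q \<in> carrier Q \<Longrightarrow>
      \<theta> (dashv D x y) q = lam W x (\<theta> y q) \<oplus>\<^bsub>W\<^esub> \<theta> x (lam Q y q)"
    and "\<And>x y q. x \<in> elems D \<Longrightarrow> y \<in> elems D \<Longrightarrow> q \<in> carrier Q \<Longrightarrow>
      \<theta> (vdash D x y) q = rho W x (\<theta> y q)"
    and "\<And>x y q. x \<in> elems D \<Longrightarrow> y \<in> elems D \<Longrightarrow> q \<in> carrier Q \<Longrightarrow>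
      \<theta> (dashv D x y) q = \<theta> x (rho Q y q)"
  shows "\<theta> \<in> carrier (cocycles K D Q W)"
proof -
  have "\<theta> \<in> elems D \<rightarrow>\<^sub>E (lin_hom K Q W \<inter> extensional (carrier Q))"
    using assms(1,2) by (auto simp: PiE_iff)
  moreover have "\<forall>x\<in>elems D. \<forall>y\<in>elems D. \<forall>q\<in>carrier Q.
          \<theta> (dashv D x y) q = lam W x (\<theta> y q) \<oplus>\<^bsub>W\<^esub> \<theta> x (lam Q y q) \<and>
          \<theta> (vdash D x y) q = rho W x (\<theta> y q) \<and>
          \<theta> (dashv D x y) q = \<theta> x (rho Q y q)"
    using assms(3-5) by blast
  ultimately show ?thesis
    unfolding carrier_cocycles by (intro CollectI conjI)
qed

lemma cocycles_add_apply:
  "x \<in> elems D \<Longrightarrow> q \<in> carrier Q \<Longrightarrow> (\<theta> \<oplus>\<^bsub>cocycles K D Q W\<^esub> \<theta>') x q = \<theta> x q \<oplus>\<^bsub>W\<^esub> \<theta>' x q"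
  by (simp add: cocycles_def)

lemma cocycles_zero_apply:
  "x \<in> elems D \<Longrightarrow> q \<in> carrier Q \<Longrightarrow> \<zero>\<^bsub>cocycles K D Q W\<^esub> x q = \<zero>\<^bsub>W\<^esub>"
  by (simp add: cocycles_def)

lemma delta_apply:
  "x \<in> elems D \<Longrightarrow> q \<in> carrier Q \<Longrightarrow> delta D Q W t x q = lam W x (t q) \<ominus>\<^bsub>W\<^esub> t (lam Q x q)"
  by (simp add: delta_def)

lemma Hom_rhoD:
  assumes "t \<in> Hom_rho K D Q W"
  shows "t \<in> lin_hom K Q W" "t \<in> extensional (carrier Q)"
    and "\<And>x q. x \<in> elems D \<Longrightarrow> q \<in> carrier Q \<Longrightarrow> t (rho Q x q) = rho W x (t q)"
  using assms by (auto simp: Hom_rho_def)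

text \<open>
  These closure properties are all that the theory of cocycles asks of the digroup; the group action
  itself is used for averaging.
\<close>

locale rep_pair = Q: digroup_rep K D Q + W: digroup_rep K D W
  for K :: "('k, 'm) ring_scheme" and D :: "'d digroup"
    and Q :: "('k, 'q, 'd) rep" and W :: "('k, 'w, 'd) rep" +
  assumes vdash_closed [simp]: "x \<in> elems D \<Longrightarrow> y \<in> elems D \<Longrightarrow> vdash D x y \<in> elems D"
    and dashv_closed [simp]: "x \<in> elems D \<Longrightarrow> y \<in> elems D \<Longrightarrow> dashv D x y \<in> elems D"
    and halo_subset: "halo D \<subseteq> elems D"
begin

lemma cocycles_add_families:
  assumes "\<theta> \<in> families D Q W" "\<theta>' \<in> families D Q W"
  shows "\<theta> \<oplus>\<^bsub>cocycles K D Q W\<^esub> \<theta>' \<in> families D Q W"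
  using families_closed[OF assms(1)] families_closed[OF assms(2)] by (simp add: cocycles_def)

lemma cocycles_zero_families: "\<zero>\<^bsub>cocycles K D Q W\<^esub> \<in> families D Q W"
  by (simp add: cocycles_def)

lemma delta_families:
  assumes "t \<in> Hom_rho K D Q W"
  shows "delta D Q W t \<in> families D Q W"
  using Hom_rhoD(1)[OF assms] by (simp add: delta_def)

lemma delta_lin_hom:
  assumes t: "t \<in> Hom_rho K D Q W" and x: "x \<in> elems D"
  shows "delta D Q W t x \<in> lin_hom K Q W"
proof (rule lin_homI)
  note t = Hom_rhoD(1)[OF t]
  show "delta D Q W t x q \<in> carrier W" if "q \<in> carrier Q" for q
    using that t x by (simp add: delta_apply)
  show "delta D Q W t x (q \<oplus>\<^bsub>Q\<^esub> r) = delta D Q W t x q \<oplus>\<^bsub>W\<^esub> delta D Q W t x r"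
    if "q \<in> carrier Q" "r \<in> carrier Q" for q r
    using that t x
    by (simp add: delta_apply lin_hom_add[OF t] Q.lam_add W.lam_add W.group_normalize)
  show "delta D Q W t x (c \<odot>\<^bsub>Q\<^esub> q) = c \<odot>\<^bsub>W\<^esub> delta D Q W t x q"
    if "c \<in> carrier K" "q \<in> carrier Q" for c q
    using that t x
    by (simp add: delta_apply lin_hom_smult[OF t] Q.lam_smult W.lam_smult
        W.smult_r_distr W.smult_r_minus a_minus_def)
qed

text \<open>
  A \<open>\<rho>\<close>-equivariant map has the cocycle identities for its coboundary.  This is stated for an arbitrary target,
  because it is applied not only to maps from \<open>Q\<close> to \<open>W\<close> but also to sections from \<open>Q\<close> to the middle term of
  an extension.
\<close>

lemma delta_identities:
  assumes t: "t \<in> Hom_rho K D Q W" and xy: "x \<in> elems D" "y \<in> elems D" and q: "q \<in> carrier Q"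
  shows "delta D Q W t (dashv D x y) q = lam W x (delta D Q W t y q) \<oplus>\<^bsub>W\<^esub> delta D Q W t x (lam Q y q)"
    and "delta D Q W t (vdash D x y) q = rho W x (delta D Q W t y q)"
    and "delta D Q W t (dashv D x y) q = delta D Q W t x (rho Q y q)"
proof -
  note lin = Hom_rhoD(1)[OF t] and eq = Hom_rhoD(3)[OF t]
  show "delta D Q W t (dashv D x y) q = lam W x (delta D Q W t y q) \<oplus>\<^bsub>W\<^esub> delta D Q W t x (lam Q y q)"
    using xy q lin
    by (simp add: delta_apply W.lam_dashv Q.lam_dashv W.lam_add W.lam_a_inv W.group_normalize)
  show "delta D Q W t (vdash D x y) q = rho W x (delta D Q W t y q)"
    using xy q lin eq[OF xy(1), of "lam Q y q"]
    by (simp add: delta_apply W.rho_minus W.rho_lam flip: Q.rho_lam)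
  show "delta D Q W t (dashv D x y) q = delta D Q W t x (rho Q y q)"
    using xy q lin eq[OF xy(2) q]
    by (simp add: delta_apply W.lam_rho Q.lam_rho)
qed

lemma zero_coboundary: "\<zero>\<^bsub>cocycles K D Q W\<^esub> \<in> coboundaries K D Q W"
proof -
  define t where "t = (\<lambda>q\<in>carrier Q. \<zero>\<^bsub>W\<^esub>)"
  have t: "t \<in> Hom_rho K D Q W"
    by (auto simp: Hom_rho_def t_def lin_hom_zero[OF W.vector_space W.vector_space W.rho_End]
        intro!: lin_homI)
  have "delta D Q W t = \<zero>\<^bsub>cocycles K D Q W\<^esub>"
    using delta_families[OF t] cocycles_zero_families
    by (rule families_eqI)
      (simp add: delta_apply cocycles_zero_apply t_def
        lin_hom_zero[OF W.vector_space W.vector_space W.lam_End])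
  then show ?thesis
    using t by (force simp: coboundaries_def)
qed

lemma coboundaries_coset_zero:
  "coboundaries K D Q W +>\<^bsub>cocycles K D Q W\<^esub> \<zero>\<^bsub>cocycles K D Q W\<^esub> = coboundaries K D Q W"
proof -
  have "b \<oplus>\<^bsub>cocycles K D Q W\<^esub> \<zero>\<^bsub>cocycles K D Q W\<^esub> = b" if "b \<in> coboundaries K D Q W" for b
  proof -
    have b: "b \<in> families D Q W"
      using that delta_families by (auto simp only: coboundaries_def)
    show ?thesis
      using cocycles_add_families[OF b cocycles_zero_families] b
      by (rule families_eqI)
        (simp add: cocycles_add_apply cocycles_zero_apply families_closed[OF b])
  qed
  then show ?thesis
    by (simp add: a_r_coset_def')
qed

end

section \<open>The coset of cocycles of an extension\<close>

text \<open>
  The condition \<open>i \<theta> = \<delta>s\<close> is the form in which the cocycle of a section is used: it avoids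
  inverting \<open>i\<close>, and identities for \<open>\<theta>\<close> follow from those for \<open>\<delta>s\<close> by injectivity of \<open>i\<close>.
\<close>

definition section_cocycles ::
  "('k, 'm) ring_scheme \<Rightarrow> 'd digroup \<Rightarrow> ('k, 'q, 'd) rep \<Rightarrow> ('k, 'w, 'd) rep
    \<Rightarrow> ('k, 'q, 'w, 'v, 'd) ext \<Rightarrow> ('d \<Rightarrow> 'q \<Rightarrow> 'w) set"
where
  "section_cocycles K D Q W = (\<lambda>(V, i, p). {\<theta> \<in> families D Q W.
     \<exists>s\<in>equivariant_sections K D Q V p.
       \<forall>x\<in>elems D. \<forall>q\<in>carrier Q. i (\<theta> x q) = delta D Q V s x q})"

locale extension = rep_pair K D Q W
  for K :: "('k, 'm) ring_scheme" and D :: "'d digroup"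
    and Q :: "('k, 'q, 'd) rep" and W :: "('k, 'w, 'd) rep" +
  fixes V :: "('k, 'v, 'd) rep" and i :: "'w \<Rightarrow> 'v" and p :: "'v \<Rightarrow> 'q"
  assumes exact: "(V, i, p) \<in> short_exact K D Q W"

sublocale extension \<subseteq> V: digroup_rep K D V
  using exact by (simp add: short_exact_def)

sublocale extension \<subseteq> QV: rep_pair K D Q V
  by unfold_locales (simp_all add: halo_subset)

context extension
begin

lemma i_hom: "i \<in> rep_hom K D W V" and p_hom: "p \<in> rep_hom K D V Q"
  and i_inj: "inj_on i (carrier W)" and i_image: "i ` carrier W = {v \<in> carrier V. p v = \<zero>\<^bsub>Q\<^esub>}"
  and p_surj: "p ` carrier V = carrier Q"
  using exact by (simp_all add: short_exact_def)

lemma i_lin: "i \<in> lin_hom K W V"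
  using i_hom by (simp add: rep_hom_def)

lemma p_lin: "p \<in> lin_hom K V Q"
  using p_hom by (simp add: rep_hom_def)

lemma i_lam: "x \<in> elems D \<Longrightarrow> w \<in> carrier W \<Longrightarrow> i (lam W x w) = lam V x (i w)"
  and i_rho: "x \<in> elems D \<Longrightarrow> w \<in> carrier W \<Longrightarrow> i (rho W x w) = rho V x (i w)"
  and p_lam: "x \<in> elems D \<Longrightarrow> v \<in> carrier V \<Longrightarrow> p (lam V x v) = lam Q x (p v)"
  and p_rho: "x \<in> elems D \<Longrightarrow> v \<in> carrier V \<Longrightarrow> p (rho V x v) = rho Q x (p v)"
  using i_hom p_hom unfolding rep_hom_def by blast+

lemmas i_closed [simp] = lin_hom_closed[OF i_lin]
lemmas p_closed [simp] = lin_hom_closed[OF p_lin]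
lemmas i_add = lin_hom_add[OF i_lin]
lemmas p_add = lin_hom_add[OF p_lin]
lemmas i_smult = lin_hom_smult[OF i_lin]
lemmas i_a_inv = lin_hom_a_inv[OF W.vector_space V.vector_space i_lin]
lemmas p_minus = lin_hom_minus[OF V.vector_space Q.vector_space p_lin]

lemma p_i: "w \<in> carrier W \<Longrightarrow> p (i w) = \<zero>\<^bsub>Q\<^esub>"
  using i_image by (simp add: set_eq_iff image_iff) metis

lemma i_eq: "w \<in> carrier W \<Longrightarrow> w' \<in> carrier W \<Longrightarrow> i w = i w' \<Longrightarrow> w = w'"
  by (rule inj_onD[OF i_inj])

definition kernel_part :: "'v \<Rightarrow> 'w" where
  "kernel_part = inv_into (carrier W) i"

lemma kernel_part:
  assumes "v \<in> carrier V" "p v = \<zero>\<^bsub>Q\<^esub>"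
  shows "kernel_part v \<in> carrier W" "i (kernel_part v) = v"
proof -
  have "v \<in> i ` carrier W"
    using assms i_image by simp
  then show "kernel_part v \<in> carrier W" "i (kernel_part v) = v"
    unfolding kernel_part_def by (rule inv_into_into, rule f_inv_into_f)
qed

lemma sectionD:
  assumes "s \<in> equivariant_sections K D Q V p"
  shows "s \<in> Hom_rho K D Q V" "s \<in> lin_hom K Q V" "\<And>q. q \<in> carrier Q \<Longrightarrow> p (s q) = q"
    and "\<And>x q. x \<in> elems D \<Longrightarrow> q \<in> carrier Q \<Longrightarrow> s (rho Q x q) = rho V x (s q)"
  using assms by (auto simp: equivariant_sections_def Hom_rho_def)

lemma section_cocyclesI:
  assumes "\<theta> \<in> families D Q W" "s \<in> equivariant_sections K D Q V p"
    and "\<And>x q. x \<in> elems D \<Longrightarrow> q \<in> carrier Q \<Longrightarrow> i (\<theta> x q) = delta D Q V s x q"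
  shows "\<theta> \<in> section_cocycles K D Q W (V, i, p)"
  unfolding section_cocycles_def using assms by (auto simp only: case_prod_conv)

lemma section_cocyclesE:
  assumes "\<theta> \<in> section_cocycles K D Q W (V, i, p)"
  obtains s where "\<theta> \<in> families D Q W" "s \<in> equivariant_sections K D Q V p"
    and "\<And>x q. x \<in> elems D \<Longrightarrow> q \<in> carrier Q \<Longrightarrow> i (\<theta> x q) = delta D Q V s x q"
  using assms unfolding section_cocycles_def by auto

lemma section_cocycles_subset:
  "section_cocycles K D Q W (V, i, p) \<subseteq> carrier (cocycles K D Q W)"
proof
  fix \<theta> assume "\<theta> \<in> section_cocycles K D Q W (V, i, p)"
  then obtain s where \<theta>: "\<theta> \<in> families D Q W" and s: "s \<in> equivariant_sections K D Q V p"
    and i\<theta>: "\<And>x q. x \<in> elems D \<Longrightarrow> q \<in> carrier Q \<Longrightarrow> i (\<theta> x q) = delta D Q V s x q"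
    by (rule section_cocyclesE) (rule that)
  note s = sectionD(1)[OF s]
  note closed [simp] = families_closed[OF \<theta>]
  show "\<theta> \<in> carrier (cocycles K D Q W)"
  proof (rule cocyclesI)
    fix x assume x: "x \<in> elems D"
    note lin = QV.delta_lin_hom[OF s x]
    show "\<theta> x \<in> lin_hom K Q W"
    proof (rule lin_homI)
      show "\<theta> x q \<in> carrier W" if "q \<in> carrier Q" for q
        using x that by simp
      show "\<theta> x (q \<oplus>\<^bsub>Q\<^esub> r) = \<theta> x q \<oplus>\<^bsub>W\<^esub> \<theta> x r" if "q \<in> carrier Q" "r \<in> carrier Q" for q r
        using x that by (intro i_eq) (simp_all add: i\<theta> i_add lin_hom_add[OF lin])
      show "\<theta> x (c \<odot>\<^bsub>Q\<^esub> q) = c \<odot>\<^bsub>W\<^esub> \<theta> x q" if "c \<in> carrier K" "q \<in> carrier Q" for c q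
        using x that by (intro i_eq) (simp_all add: i\<theta> i_smult lin_hom_smult[OF lin])
    qed
  next
    fix x y q assume xyq: "x \<in> elems D" "y \<in> elems D" "q \<in> carrier Q"
    note delta = QV.delta_identities[OF s xyq]
    show "\<theta> (dashv D x y) q = lam W x (\<theta> y q) \<oplus>\<^bsub>W\<^esub> \<theta> x (lam Q y q)"
      using xyq by (intro i_eq) (simp_all add: i\<theta> i_add i_lam delta(1))
    show "\<theta> (vdash D x y) q = rho W x (\<theta> y q)"
      using xyq by (intro i_eq) (simp_all add: i\<theta> i_rho delta(2))
    show "\<theta> (dashv D x y) q = \<theta> x (rho Q y q)"
      using xyq by (intro i_eq) (simp_all add: i\<theta> delta(3))
  qed (fact \<theta>)
qed

text \<open>
  As \<open>p\<close> commutes with \<open>\<lambda>\<close> and \<open>p s\<close> is the identity, \<open>p (\<lambda>\<^sub>x s q - s \<lambda>\<^sub>x q)\<close> is zero, so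
  \<open>\<delta>s\<close> takes values in the image of \<open>i\<close>.
\<close>

lemma section_cocycles_nonempty:
  assumes "equivariant_sections K D Q V p \<noteq> {}"
  shows "section_cocycles K D Q W (V, i, p) \<noteq> {}"
proof -
  obtain s where s: "s \<in> equivariant_sections K D Q V p"
    using assms by blast
  note lin = sectionD(2)[OF s]
  define \<theta> where "\<theta> = (\<lambda>x\<in>elems D. \<lambda>q\<in>carrier Q. kernel_part (delta D Q V s x q))"
  have kernel: "delta D Q V s x q \<in> carrier V" "p (delta D Q V s x q) = \<zero>\<^bsub>Q\<^esub>"
    if "x \<in> elems D" "q \<in> carrier Q" for x q
    using that lin by (simp_all add: delta_apply p_minus p_lam sectionD(3)[OF s])
  have "\<theta> \<in> families D Q W"
    using kernel_part(1)[OF kernel] by (simp add: \<theta>_def)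
  moreover have "i (\<theta> x q) = delta D Q V s x q" if "x \<in> elems D" "q \<in> carrier Q" for x q
    using kernel_part(2)[OF kernel[OF that]] that by (simp add: \<theta>_def)
  ultimately show ?thesis
    using section_cocyclesI[of \<theta> s] s by blast
qed

text \<open>
  If \<open>s\<close> is an equivariant section with cocycle \<open>\<theta>\<close>, the others are the maps \<open>i t + s\<close> with
  \<open>t\<close> in \<open>Hom\<^sub>\<rho>(Q, W)\<close>, and \<open>\<delta>(i t + s) = i (\<delta>t + \<theta>)\<close>.
\<close>

lemma section_cocycles_coset:
  assumes \<theta>: "\<theta> \<in> section_cocycles K D Q W (V, i, p)"
  shows "section_cocycles K D Q W (V, i, p) = coboundaries K D Q W +>\<^bsub>cocycles K D Q W\<^esub> \<theta>"
proof -
  obtain s where \<theta>_fam: "\<theta> \<in> families D Q W" and s: "s \<in> equivariant_sections K D Q V p"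
    and i\<theta>: "\<And>x q. x \<in> elems D \<Longrightarrow> q \<in> carrier Q \<Longrightarrow> i (\<theta> x q) = delta D Q V s x q"
    using \<theta> by (rule section_cocyclesE) (rule that)
  note s_lin = sectionD(2)[OF s] and p_s = sectionD(3)[OF s] and s_rho = sectionD(4)[OF s]
  note [simp] = lin_hom_closed[OF s_lin] families_closed[OF \<theta>_fam]
  have "\<theta>' \<in> section_cocycles K D Q W (V, i, p)"
    if t: "t \<in> Hom_rho K D Q W" and \<theta>': "\<theta>' = delta D Q W t \<oplus>\<^bsub>cocycles K D Q W\<^esub> \<theta>" for t \<theta>'
  proof -
    note t_lin = Hom_rhoD(1)[OF t]
    note [simp] = lin_hom_closed[OF t_lin]
    define s' where "s' = (\<lambda>q\<in>carrier Q. i (t q) \<oplus>\<^bsub>V\<^esub> s q)"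
    have "s' \<in> lin_hom K Q V"
      by (rule lin_homI)
        (simp_all add: s'_def lin_hom_add[OF t_lin] lin_hom_add[OF s_lin] i_add V.group_normalize
          lin_hom_smult[OF t_lin] lin_hom_smult[OF s_lin] i_smult V.smult_r_distr)
    then have "s' \<in> equivariant_sections K D Q V p"
      by (simp add: equivariant_sections_def Hom_rho_def s'_def p_add p_i p_s V.rho_add s_rho
          Hom_rhoD(3)[OF t] i_rho)
    moreover have "i (\<theta>' x q) = delta D Q V s' x q" if "x \<in> elems D" "q \<in> carrier Q" for x q
      using that by (simp add: \<theta>' cocycles_add_apply delta_apply i_add i\<theta> i_a_inv i_lam s'_def
          V.lam_add V.group_normalize)
    moreover have "\<theta>' \<in> families D Q W"
      unfolding \<theta>' using delta_families[OF t] \<theta>_fam by (rule cocycles_add_families)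
    ultimately show ?thesis
      using section_cocyclesI[of \<theta>' s'] by blast
  qed
  moreover have "\<exists>t\<in>Hom_rho K D Q W. \<theta>' = delta D Q W t \<oplus>\<^bsub>cocycles K D Q W\<^esub> \<theta>"
    if \<theta>': "\<theta>' \<in> section_cocycles K D Q W (V, i, p)" for \<theta>'
  proof -
    obtain s' where \<theta>'_fam: "\<theta>' \<in> families D Q W" and s': "s' \<in> equivariant_sections K D Q V p"
      and i\<theta>': "\<And>x q. x \<in> elems D \<Longrightarrow> q \<in> carrier Q \<Longrightarrow> i (\<theta>' x q) = delta D Q V s' x q"
      using \<theta>' by (rule section_cocyclesE) (rule that)
    note s'_lin = sectionD(2)[OF s'] and p_s' = sectionD(3)[OF s'] and s'_rho = sectionD(4)[OF s']
    note [simp] = lin_hom_closed[OF s'_lin] families_closed[OF \<theta>'_fam]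
    define t where "t = (\<lambda>q\<in>carrier Q. kernel_part (s' q \<ominus>\<^bsub>V\<^esub> s q))"
    have t_closed [simp]: "t q \<in> carrier W" and i_t: "i (t q) = s' q \<ominus>\<^bsub>V\<^esub> s q" if "q \<in> carrier Q" for q
      using kernel_part[of "s' q \<ominus>\<^bsub>V\<^esub> s q"] that by (simp_all add: t_def p_minus p_s p_s')
    have "t \<in> lin_hom K Q W"
    proof (rule lin_homI)
      show "t (q \<oplus>\<^bsub>Q\<^esub> r) = t q \<oplus>\<^bsub>W\<^esub> t r" if "q \<in> carrier Q" "r \<in> carrier Q" for q r
        using that by (intro i_eq) (simp_all add: i_t i_add lin_hom_add[OF s_lin]
            lin_hom_add[OF s'_lin] V.group_normalize)
      show "t (c \<odot>\<^bsub>Q\<^esub> q) = c \<odot>\<^bsub>W\<^esub> t q" if "c \<in> carrier K" "q \<in> carrier Q" for c q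
        using that by (intro i_eq) (simp_all add: i_t i_smult lin_hom_smult[OF s_lin]
            lin_hom_smult[OF s'_lin] a_minus_def V.smult_r_distr V.smult_r_minus)
    qed simp
    moreover have "rho W x (t q) = t (rho Q x q)" if "x \<in> elems D" "q \<in> carrier Q" for x q
      using that by (intro i_eq) (simp_all add: i_t i_rho V.rho_minus s_rho s'_rho)
    ultimately have t: "t \<in> Hom_rho K D Q W"
      by (simp add: Hom_rho_def t_def)
    have "\<theta>' = delta D Q W t \<oplus>\<^bsub>cocycles K D Q W\<^esub> \<theta>"
      using \<theta>'_fam cocycles_add_families[OF delta_families[OF t] \<theta>_fam]
    proof (rule families_eqI)
      fix x q assume "x \<in> elems D" "q \<in> carrier Q"
      then show "\<theta>' x q = (delta D Q W t \<oplus>\<^bsub>cocycles K D Q W\<^esub> \<theta>) x q"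
        by (intro i_eq) (simp_all add: cocycles_add_apply delta_apply i\<theta>' i_add i\<theta> i_a_inv i_lam
            i_t V.lam_add V.lam_a_inv V.group_normalize)
    qed
    then show ?thesis
      using t by blast
  qed
  ultimately show ?thesis
    by (auto simp add: a_r_coset_def' coboundaries_def)
qed

text \<open>
  An equivariant section \<open>s\<close> is a morphism of representations exactly if \<open>\<delta>s\<close> vanishes.
\<close>

lemma splits_iff_zero_section_cocycle:
  "splits K D Q (V, i, p) \<longleftrightarrow> \<zero>\<^bsub>cocycles K D Q W\<^esub> \<in> section_cocycles K D Q W (V, i, p)"
proof
  assume "splits K D Q (V, i, p)"
  then obtain s where "s \<in> rep_hom K D Q V" and p_s: "\<And>q. q \<in> carrier Q \<Longrightarrow> p (s q) = q"
    unfolding splits_def by blast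
  then have s: "s \<in> lin_hom K Q V"
      "\<And>x q. x \<in> elems D \<Longrightarrow> q \<in> carrier Q \<Longrightarrow> s (lam Q x q) = lam V x (s q)"
      "\<And>x q. x \<in> elems D \<Longrightarrow> q \<in> carrier Q \<Longrightarrow> s (rho Q x q) = rho V x (s q)"
    unfolding rep_hom_def by blast+
  define s' where "s' = restrict s (carrier Q)"
  have s': "s' \<in> equivariant_sections K D Q V p"
    using lin_hom_restrict[OF Q.vector_space s(1)] p_s s(3)
    by (simp add: equivariant_sections_def Hom_rho_def s'_def)
  have "i (\<zero>\<^bsub>cocycles K D Q W\<^esub> x q) = delta D Q V s' x q" if "x \<in> elems D" "q \<in> carrier Q" for x q
    using that lin_hom_zero[OF W.vector_space V.vector_space i_lin] s
    by (simp add: cocycles_zero_apply delta_apply s'_def a_minus_def V.r_neg)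
  then show "\<zero>\<^bsub>cocycles K D Q W\<^esub> \<in> section_cocycles K D Q W (V, i, p)"
    using section_cocyclesI[OF cocycles_zero_families s'] by blast
next
  assume "\<zero>\<^bsub>cocycles K D Q W\<^esub> \<in> section_cocycles K D Q W (V, i, p)"
  then obtain s where s: "s \<in> equivariant_sections K D Q V p"
    and zero: "\<And>x q. x \<in> elems D \<Longrightarrow> q \<in> carrier Q \<Longrightarrow>
      i (\<zero>\<^bsub>cocycles K D Q W\<^esub> x q) = delta D Q V s x q"
    by (rule section_cocyclesE) (rule that)
  have "s (lam Q x q) = lam V x (s q)" if "x \<in> elems D" "q \<in> carrier Q" for x q
  proof -
    have "lam V x (s q) \<ominus>\<^bsub>V\<^esub> s (lam Q x q) = \<zero>\<^bsub>V\<^esub>"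
      using zero[OF that] that lin_hom_zero[OF W.vector_space V.vector_space i_lin]
      by (simp add: cocycles_zero_apply delta_apply)
    then show ?thesis
      using that sectionD(2)[OF s] by simp
  qed
  then have "s \<in> rep_hom K D Q V"
    using sectionD(2,4)[OF s] by (simp add: rep_hom_def)
  then show "splits K D Q (V, i, p)"
    unfolding splits_def using sectionD(3)[OF s] by blast
qed

end

section \<open>Twisted sums\<close>

text \<open>
  A representation on \<open>W \<times> Q\<close>, with \<open>\<lambda>\<close> sheared by a cocycle, in coordinates \<open>c\<close>.  The coordinates are
  kept abstract because they arise in two ways: as \<open>i w + s q\<close> in a given extension, and as an arbitrary
  injection into the type in which the middle terms live.
\<close>

locale twisted_sum = rep_pair K D Q W
  for K :: "('k, 'm) ring_scheme" and D :: "'d digroup"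
    and Q :: "('k, 'q, 'd) rep" and W :: "('k, 'w, 'd) rep" +
  fixes \<theta> :: "'d \<Rightarrow> 'q \<Rightarrow> 'w" and V :: "('k, 'v, 'd) rep" and c :: "'w \<times> 'q \<Rightarrow> 'v"
  assumes cocycle: "\<theta> \<in> carrier (cocycles K D Q W)"
    and bij: "bij_betw c (carrier W \<times> carrier Q) (carrier V)"
    and zero_c: "\<zero>\<^bsub>V\<^esub> = c (\<zero>\<^bsub>W\<^esub>, \<zero>\<^bsub>Q\<^esub>)"
    and add_c: "\<lbrakk>w \<in> carrier W; q \<in> carrier Q; w' \<in> carrier W; q' \<in> carrier Q\<rbrakk>
      \<Longrightarrow> c (w, q) \<oplus>\<^bsub>V\<^esub> c (w', q') = c (w \<oplus>\<^bsub>W\<^esub> w', q \<oplus>\<^bsub>Q\<^esub> q')"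
    and smult_c: "\<lbrakk>k \<in> carrier K; w \<in> carrier W; q \<in> carrier Q\<rbrakk>
      \<Longrightarrow> k \<odot>\<^bsub>V\<^esub> c (w, q) = c (k \<odot>\<^bsub>W\<^esub> w, k \<odot>\<^bsub>Q\<^esub> q)"
    and lam_c: "\<lbrakk>x \<in> elems D; w \<in> carrier W; q \<in> carrier Q\<rbrakk>
      \<Longrightarrow> lam V x (c (w, q)) = c (lam W x w \<oplus>\<^bsub>W\<^esub> \<theta> x q, lam Q x q)"
    and rho_c: "\<lbrakk>x \<in> elems D; w \<in> carrier W; q \<in> carrier Q\<rbrakk>
      \<Longrightarrow> rho V x (c (w, q)) = c (rho W x w, rho Q x q)"
begin

lemma c_closed [simp]: "w \<in> carrier W \<Longrightarrow> q \<in> carrier Q \<Longrightarrow> c (w, q) \<in> carrier V"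
  using bij by (auto simp: bij_betw_def)

lemma c_cases:
  assumes "v \<in> carrier V"
  obtains w q where "w \<in> carrier W" "q \<in> carrier Q" "v = c (w, q)"
proof -
  have "v \<in> c ` (carrier W \<times> carrier Q)"
    using assms bij_betw_imp_surj_on[OF bij] by simp
  then show ?thesis
    using that by auto
qed

lemma c_eq_iff:
  "\<lbrakk>w \<in> carrier W; q \<in> carrier Q; w' \<in> carrier W; q' \<in> carrier Q\<rbrakk>
    \<Longrightarrow> c (w, q) = c (w', q') \<longleftrightarrow> w = w' \<and> q = q'"
  using inj_on_eq_iff[OF bij_betw_imp_inj_on[OF bij], of "(w, q)" "(w', q')"] by simp

lemma inv_c: "w \<in> carrier W \<Longrightarrow> q \<in> carrier Q \<Longrightarrow> inv_into (carrier W \<times> carrier Q) c (c (w, q)) = (w, q)"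
  by (rule inv_into_f_f[OF bij_betw_imp_inj_on[OF bij]]) simp

lemma theta_closed [simp]: "x \<in> elems D \<Longrightarrow> q \<in> carrier Q \<Longrightarrow> \<theta> x q \<in> carrier W"
  by (rule families_closed[OF cocyclesD(1)[OF cocycle]])

lemmas theta_lin = cocyclesD(2)[OF cocycle]

lemma module_V: "module K V"
proof (rule moduleI)
  show "cring K"
    by (rule Q.R.is_cring)
  show "abelian_group V"
  proof (rule abelian_groupI)
    show "\<exists>u\<in>carrier V. u \<oplus>\<^bsub>V\<^esub> v = \<zero>\<^bsub>V\<^esub>" if "v \<in> carrier V" for v
    proof -
      obtain w q where wq: "w \<in> carrier W" "q \<in> carrier Q" "v = c (w, q)"
        using c_cases[OF \<open>v \<in> carrier V\<close>] by blast
      then have "c (\<ominus>\<^bsub>W\<^esub> w, \<ominus>\<^bsub>Q\<^esub> q) \<oplus>\<^bsub>V\<^esub> v = \<zero>\<^bsub>V\<^esub>"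
        by (simp add: add_c zero_c W.l_neg Q.l_neg)
      then show ?thesis
        using wq c_closed[of "\<ominus>\<^bsub>W\<^esub> w" "\<ominus>\<^bsub>Q\<^esub> q"] by auto
    qed
  qed (auto elim!: c_cases simp: add_c zero_c W.a_ac Q.a_ac)
qed (auto elim!: c_cases simp: add_c smult_c W.smult_l_distr Q.smult_l_distr W.smult_r_distr
    Q.smult_r_distr W.smult_assoc1 Q.smult_assoc1)

text \<open>
  Each cocycle identity is what one axiom requires of the shear term: the first is multiplicativity
  of \<open>\<lambda>\<close>, the second the compatibility of \<open>\<rho>\<^sub>x \<lambda>\<^sub>y\<close>, the third that of \<open>\<lambda>\<^sub>x \<rho>\<^sub>y\<close>.
\<close>

lemma rep_V: "digroup_rep K D V"
proof (rule digroup_rep.intro)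
  show "field K" by (rule Q.field)
  show "module K V" by (rule module_V)
next
  fix x assume x: "x \<in> elems D"
  show "lam V x \<in> lin_hom K V V"
    by (rule lin_homI)
      (use x in \<open>auto elim!: c_cases simp: add_c smult_c lam_c W.lam_add Q.lam_add W.lam_smult
        Q.lam_smult lin_hom_add[OF theta_lin] lin_hom_smult[OF theta_lin] W.smult_r_distr W.a_ac\<close>)
  show "rho V x \<in> lin_hom K V V"
    by (rule lin_homI)
      (use x in \<open>auto elim!: c_cases simp: add_c smult_c rho_c W.rho_add Q.rho_add W.rho_smult
        Q.rho_smult\<close>)
  show "bij_betw (rho V x) (carrier V) (carrier V)"
  proof (rule bij_betw_imageI)
    have W: "inj_on (rho W x) (carrier W)" "rho W x ` carrier W = carrier W"
      and Q: "inj_on (rho Q x) (carrier Q)" "rho Q x ` carrier Q = carrier Q"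
      using W.rho_bij[OF x] Q.rho_bij[OF x] by (auto simp: bij_betw_def)
    show "inj_on (rho V x) (carrier V)"
      by (rule inj_onI)
        (use x in \<open>auto elim!: c_cases simp: rho_c c_eq_iff inj_on_eq_iff[OF W(1)] inj_on_eq_iff[OF Q(1)]\<close>)
    show "rho V x ` carrier V = carrier V"
    proof
      show "rho V x ` carrier V \<subseteq> carrier V"
        using x by (auto elim!: c_cases simp: rho_c)
      show "carrier V \<subseteq> rho V x ` carrier V"
      proof
        fix v assume "v \<in> carrier V"
        then obtain w q where wq: "w \<in> carrier W" "q \<in> carrier Q" "v = c (w, q)"
          using c_cases by blast
        then have "w \<in> rho W x ` carrier W" "q \<in> rho Q x ` carrier Q"
          using W(2) Q(2) by simp_all
        then obtain w' q' where "w' \<in> carrier W" "w = rho W x w'" "q' \<in> carrier Q" "q = rho Q x q'"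
          by auto
        then have "v = rho V x (c (w', q'))" "c (w', q') \<in> carrier V"
          using x wq by (simp_all add: rho_c)
        then show "v \<in> rho V x ` carrier V"
          by (rule image_eqI)
      qed
    qed
  qed
next
  fix x y v assume xy: "x \<in> elems D" "y \<in> elems D" and "v \<in> carrier V"
  then obtain w q where wq [simp]: "w \<in> carrier W" "q \<in> carrier Q" "v = c (w, q)"
    using c_cases by blast
  note [simp] = xy
  show "lam V (dashv D x y) v = lam V x (lam V y v)"
    by (simp add: lam_c W.lam_dashv Q.lam_dashv W.lam_add cocyclesD(3)[OF cocycle] W.a_assoc)
  show "rho V (vdash D x y) v = rho V x (rho V y v)"
    by (simp add: rho_c W.rho_vdash Q.rho_vdash)
  show "rho V x (lam V y v) = lam V (vdash D x y) v"
    by (simp add: rho_c lam_c W.rho_add W.rho_lam Q.rho_lam cocyclesD(4)[OF cocycle])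
  show "lam V x (rho V y v) = lam V (dashv D x y) v"
    by (simp add: rho_c lam_c W.lam_rho Q.lam_rho cocyclesD(5)[OF cocycle])
next
  fix e v assume e: "e \<in> halo D" and "v \<in> carrier V"
  then obtain w q where "w \<in> carrier W" "q \<in> carrier Q" "v = c (w, q)"
    using c_cases by blast
  then show "rho V e v = v"
    using subsetD[OF halo_subset e] by (simp add: rho_c W.rho_halo[OF e] Q.rho_halo[OF e])
qed

lemma c_zero_lin: "(\<lambda>w. c (w, \<zero>\<^bsub>Q\<^esub>)) \<in> lin_hom K W V"
  by (rule lin_homI) (simp_all add: add_c smult_c)

text \<open>
  The section \<open>q \<mapsto> (0, q)\<close> is equivariant because \<open>\<rho>\<close> acts diagonally, and \<open>\<lambda>\<^sub>x(0, q) = (\<theta>\<^sub>x q, \<lambda>\<^sub>x q)\<close>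
  shows that its cocycle is \<open>\<theta>\<close>.
\<close>

lemma realizes_cocycle:
  fixes i p defines "i \<equiv> \<lambda>w. c (w, \<zero>\<^bsub>Q\<^esub>)" and "p \<equiv> \<lambda>v. snd (inv_into (carrier W \<times> carrier Q) c v)"
  shows "(V, i, p) \<in> short_exact K D Q W" and "\<theta> \<in> section_cocycles K D Q W (V, i, p)"
proof -
  note lam_zero [simp] = lin_hom_zero[OF Q.vector_space Q.vector_space Q.lam_End]
    lin_hom_zero[OF W.vector_space W.vector_space W.lam_End]
  note rho_zero [simp] = lin_hom_zero[OF Q.vector_space Q.vector_space Q.rho_End]
    lin_hom_zero[OF W.vector_space W.vector_space W.rho_End]
  note theta_zero [simp] = lin_hom_zero[OF Q.vector_space W.vector_space theta_lin]
  interpret V: digroup_rep K D V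
    by (rule rep_V)
  have p_c [simp]: "p (c (w, q)) = q" if "w \<in> carrier W" "q \<in> carrier Q" for w q
    using that by (simp add: p_def inv_c)
  show exact: "(V, i, p) \<in> short_exact K D Q W"
  proof -
    have "i \<in> rep_hom K D W V"
      unfolding rep_hom_def using c_zero_lin by (simp add: i_def lam_c rho_c)
    moreover have "p \<in> lin_hom K V Q"
      by (rule lin_homI) (auto elim!: c_cases simp: add_c smult_c)
    then have "p \<in> rep_hom K D V Q"
      unfolding rep_hom_def by (auto elim!: c_cases simp: lam_c rho_c)
    moreover have "inj_on i (carrier W)"
      by (rule inj_onI) (simp add: i_def c_eq_iff)
    moreover have "i ` carrier W = {v \<in> carrier V. p v = \<zero>\<^bsub>Q\<^esub>}"
      by (auto elim!: c_cases simp: i_def)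
    moreover have "p ` carrier V = carrier Q"
    proof
      show "p ` carrier V \<subseteq> carrier Q"
        by (auto elim!: c_cases)
      show "carrier Q \<subseteq> p ` carrier V"
      proof
        fix q assume "q \<in> carrier Q"
        then show "q \<in> p ` carrier V"
          by (intro image_eqI[of _ _ "c (\<zero>\<^bsub>W\<^esub>, q)"]) simp_all
      qed
    qed
    ultimately show ?thesis
      using rep_V by (simp add: short_exact_def)
  qed
  interpret extension K D Q W V i p
    by unfold_locales (rule exact)
  define s where "s = (\<lambda>q\<in>carrier Q. c (\<zero>\<^bsub>W\<^esub>, q))"
  have "s \<in> lin_hom K Q V"
    by (rule lin_homI) (simp_all add: s_def add_c smult_c)
  then have "s \<in> equivariant_sections K D Q V p"
    by (simp add: equivariant_sections_def Hom_rho_def s_def rho_c)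
  moreover have "i (\<theta> x q) = delta D Q V s x q" if "x \<in> elems D" "q \<in> carrier Q" for x q
    unfolding delta_apply[OF that] using that
    by (intro V.minus_eqI[symmetric]) (simp_all add: s_def i_def lam_c add_c)
  ultimately show "\<theta> \<in> section_cocycles K D Q W (V, i, p)"
    by (rule section_cocyclesI[OF cocyclesD(1)[OF cocycle]])
qed

end

text \<open>
  The sheared structure on \<open>W \<times> Q\<close>, transported along \<open>j\<close>.
\<close>

definition twisted_rep ::
  "('k, 'q, 'd) rep \<Rightarrow> ('k, 'w, 'd) rep \<Rightarrow> ('d \<Rightarrow> 'q \<Rightarrow> 'w) \<Rightarrow> ('w \<times> 'q \<Rightarrow> 'v) \<Rightarrow> ('k, 'v, 'd) rep"
where
  "twisted_rep Q W \<theta> j = (let co = inv_into (carrier W \<times> carrier Q) j in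
     \<lparr>carrier = j ` (carrier W \<times> carrier Q),
      monoid.mult = undefined,
      one = undefined,
      zero = j (\<zero>\<^bsub>W\<^esub>, \<zero>\<^bsub>Q\<^esub>),
      add = (\<lambda>u v. j (fst (co u) \<oplus>\<^bsub>W\<^esub> fst (co v), snd (co u) \<oplus>\<^bsub>Q\<^esub> snd (co v))),
      smult = (\<lambda>k v. j (k \<odot>\<^bsub>W\<^esub> fst (co v), k \<odot>\<^bsub>Q\<^esub> snd (co v))),
      lam = (\<lambda>x v. j (lam W x (fst (co v)) \<oplus>\<^bsub>W\<^esub> \<theta> x (snd (co v)), lam Q x (snd (co v)))),
      rho = (\<lambda>x v. j (rho W x (fst (co v)), rho Q x (snd (co v))))\<rparr>)"

lemma (in rep_pair) twisted_sum_twisted_rep: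
  assumes \<theta>: "\<theta> \<in> carrier (cocycles K D Q W)" and j: "inj_on j (carrier W \<times> carrier Q)"
  shows "twisted_sum K D Q W \<theta> (twisted_rep Q W \<theta> j) j"
proof -
  have [simp]: "inv_into (carrier W \<times> carrier Q) j (j (w, q)) = (w, q)"
    if "w \<in> carrier W" "q \<in> carrier Q" for w q
    using that by (intro inv_into_f_f[OF j]) simp
  show ?thesis
    by unfold_locales (simp_all add: \<theta> twisted_rep_def Let_def bij_betw_def j)
qed

text \<open>
  The defining formulas of a twisted sum mention nothing but \<open>Q\<close>, \<open>W\<close> and \<open>\<theta>\<close>, so passing from one
  coordinate system to the other is a morphism.
\<close>

lemma twisted_sum_iso:
  assumes V: "twisted_sum K D Q W \<theta> V c" and V': "twisted_sum K D Q W \<theta> V' c'"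
  obtains f where "f \<in> rep_hom K D V V'" "bij_betw f (carrier V) (carrier V')"
    "\<And>w q. w \<in> carrier W \<Longrightarrow> q \<in> carrier Q \<Longrightarrow> f (c (w, q)) = c' (w, q)"
proof -
  interpret V: twisted_sum K D Q W \<theta> V c by (rule V)
  interpret V': twisted_sum K D Q W \<theta> V' c' by (rule V')
  define f where "f = c' \<circ> inv_into (carrier W \<times> carrier Q) c"
  have f_c: "f (c (w, q)) = c' (w, q)" if "w \<in> carrier W" "q \<in> carrier Q" for w q
    using that by (simp add: f_def V.inv_c)
  have "bij_betw f (carrier V) (carrier V')"
    unfolding f_def by (rule bij_betw_trans[OF bij_betw_inv_into[OF V.bij] V'.bij])
  moreover have "f \<in> lin_hom K V V'"
    by (rule lin_homI)
      (auto elim!: V.c_cases simp: f_c V.add_c V'.add_c V.smult_c V'.smult_c)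
  then have "f \<in> rep_hom K D V V'"
    unfolding rep_hom_def
    by (auto elim!: V.c_cases simp: f_c V.lam_c V'.lam_c V.rho_c V'.rho_c)
  ultimately show ?thesis
    using f_c that by blast
qed

context extension
begin

text \<open>
  The coordinates are \<open>(w, q) \<mapsto> i w + s q\<close>.  The relation \<open>\<lambda>\<^sub>x (s q) = i (\<theta>\<^sub>x q) + s (\<lambda>\<^sub>x q)\<close>, a
  rearrangement of \<open>i \<theta> = \<delta>s\<close>, produces the shear, and equivariance of \<open>s\<close> makes \<open>\<rho>\<close> diagonal.
\<close>

lemma twisted_sum_of_section_cocycle:
  assumes "\<theta> \<in> section_cocycles K D Q W (V, i, p)"
  obtains c where "twisted_sum K D Q W \<theta> V c"
    "\<And>w. w \<in> carrier W \<Longrightarrow> c (w, \<zero>\<^bsub>Q\<^esub>) = i w"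
    "\<And>w q. w \<in> carrier W \<Longrightarrow> q \<in> carrier Q \<Longrightarrow> p (c (w, q)) = q"
proof -
  obtain s where \<theta>: "\<theta> \<in> families D Q W" and s: "s \<in> equivariant_sections K D Q V p"
    and i\<theta>: "\<And>x q. x \<in> elems D \<Longrightarrow> q \<in> carrier Q \<Longrightarrow> i (\<theta> x q) = delta D Q V s x q"
    using assms by (rule section_cocyclesE) (rule that)
  note s_lin = sectionD(2)[OF s] and p_s = sectionD(3)[OF s] and s_rho = sectionD(4)[OF s]
  note [simp] = lin_hom_closed[OF s_lin] families_closed[OF \<theta>]
  define c where "c = (\<lambda>(w, q). i w \<oplus>\<^bsub>V\<^esub> s q)"
  have p_c: "p (c (w, q)) = q" if "w \<in> carrier W" "q \<in> carrier Q" for w q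
    using that by (simp add: c_def p_add p_i p_s)
  have inj: "inj_on c (carrier W \<times> carrier Q)"
  proof (rule inj_onI, clarify)
    fix w q w' q' assume *: "w \<in> carrier W" "q \<in> carrier Q" "w' \<in> carrier W" "q' \<in> carrier Q"
      "c (w, q) = c (w', q')"
    then have "q = q'"
      using p_c[of w q] p_c[of w' q'] by simp
    then have "i w = i w'"
      using * by (simp add: c_def)
    then show "w = w' \<and> q = q'"
      using * i_eq \<open>q = q'\<close> by blast
  qed
  have image: "c ` (carrier W \<times> carrier Q) = carrier V"
  proof
    show "c ` (carrier W \<times> carrier Q) \<subseteq> carrier V"
      by (auto simp: c_def)
    show "carrier V \<subseteq> c ` (carrier W \<times> carrier Q)"
    proof
      fix v assume v: "v \<in> carrier V"
      define w where "w = kernel_part (v \<ominus>\<^bsub>V\<^esub> s (p v))"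
      have w: "w \<in> carrier W" "i w = v \<ominus>\<^bsub>V\<^esub> s (p v)"
        unfolding w_def using v by (intro kernel_part; simp add: p_minus p_s)+
      then have "v = c (w, p v)"
        using v by (simp add: c_def V.group_normalize)
      then show "v \<in> c ` (carrier W \<times> carrier Q)"
        by (rule image_eqI) (use v w in simp)
    qed
  qed
  have s_zero: "s \<zero>\<^bsub>Q\<^esub> = \<zero>\<^bsub>V\<^esub>"
    by (rule lin_hom_zero[OF Q.vector_space V.vector_space s_lin])
  have lam_s: "lam V x (s q) = i (\<theta> x q) \<oplus>\<^bsub>V\<^esub> s (lam Q x q)" if "x \<in> elems D" "q \<in> carrier Q" for x q
    using that by (simp add: i\<theta> delta_apply V.group_normalize)
  have "twisted_sum K D Q W \<theta> V c"
  proof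
    show "\<theta> \<in> carrier (cocycles K D Q W)"
      using assms section_cocycles_subset by blast
    show "bij_betw c (carrier W \<times> carrier Q) (carrier V)"
      using inj image by (simp add: bij_betw_def)
    show "\<zero>\<^bsub>V\<^esub> = c (\<zero>\<^bsub>W\<^esub>, \<zero>\<^bsub>Q\<^esub>)"
      by (simp add: c_def s_zero lin_hom_zero[OF W.vector_space V.vector_space i_lin])
  qed (simp_all add: c_def i_add lin_hom_add[OF s_lin] i_smult lin_hom_smult[OF s_lin] V.smult_r_distr
      V.lam_add V.rho_add lam_s i_lam i_rho s_rho V.a_ac)
  moreover have "c (w, \<zero>\<^bsub>Q\<^esub>) = i w" if "w \<in> carrier W" for w
    using that by (simp add: c_def s_zero)
  ultimately show ?thesis
    using p_c that by blast
qed

end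

section \<open>The classification of extensions\<close>

context rep_pair
begin

lemma extensionI: "\<xi> \<in> short_exact K D Q W \<Longrightarrow> \<xi> = (V, i, p) \<Longrightarrow> extension K D Q W V i p"
  by unfold_locales simp

text \<open>
  Both middle terms are twisted sums by the same cocycle, and their coordinates are compatible with the
  inclusion of \<open>W\<close> and the projection to \<open>Q\<close>.
\<close>

lemma ext_equivI:
  assumes \<xi>: "\<xi> \<in> short_exact K D Q W" and \<xi>': "\<xi>' \<in> short_exact K D Q W"
    and \<theta>: "\<theta> \<in> section_cocycles K D Q W \<xi>" "\<theta> \<in> section_cocycles K D Q W \<xi>'"
  shows "(\<xi>, \<xi>') \<in> ext_equiv K D Q W"
proof -
  obtain V i p V' i' p' where eq: "\<xi> = (V, i, p)" "\<xi>' = (V', i', p')"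
    by (cases \<xi>, cases \<xi>') auto
  interpret V: extension K D Q W V i p
    using \<xi> eq(1) by (rule extensionI)
  interpret V': extension K D Q W V' i' p'
    using \<xi>' eq(2) by (rule extensionI)
  obtain c where c: "twisted_sum K D Q W \<theta> V c"
    "\<And>w. w \<in> carrier W \<Longrightarrow> c (w, \<zero>\<^bsub>Q\<^esub>) = i w"
    "\<And>w q. w \<in> carrier W \<Longrightarrow> q \<in> carrier Q \<Longrightarrow> p (c (w, q)) = q"
    using V.twisted_sum_of_section_cocycle[OF \<theta>(1)[unfolded eq]] by blast
  obtain c' where c': "twisted_sum K D Q W \<theta> V' c'"
    "\<And>w. w \<in> carrier W \<Longrightarrow> c' (w, \<zero>\<^bsub>Q\<^esub>) = i' w"
    "\<And>w q. w \<in> carrier W \<Longrightarrow> q \<in> carrier Q \<Longrightarrow> p' (c' (w, q)) = q"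
    using V'.twisted_sum_of_section_cocycle[OF \<theta>(2)[unfolded eq]] by blast
  obtain f where f: "f \<in> rep_hom K D V V'" "bij_betw f (carrier V) (carrier V')"
    "\<And>w q. w \<in> carrier W \<Longrightarrow> q \<in> carrier Q \<Longrightarrow> f (c (w, q)) = c' (w, q)"
    using twisted_sum_iso[OF c(1) c'(1)] by blast
  have "f (i w) = i' w" if "w \<in> carrier W" for w
    using f(3)[OF that Q.zero_closed] c(2) c'(2) that by simp
  moreover have "p' (f v) = p v" if v: "v \<in> carrier V" for v
  proof -
    obtain w q where "w \<in> carrier W" "q \<in> carrier Q" "v = c (w, q)"
      using twisted_sum.c_cases[OF c(1) v] by blast
    then show ?thesis
      by (simp add: f(3) c(3) c'(3))
  qed
  ultimately show ?thesis
    unfolding eq ext_equiv_def using f(1,2) V.exact V'.exact by blast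
qed

text \<open>
  If \<open>f\<close> is the isomorphism and \<open>s\<close> a section with cocycle \<open>\<theta>\<close>, then \<open>f s\<close> is a section of the other
  extension, and \<open>\<delta>(f s) = f \<delta>s = f i \<theta> = i' \<theta>\<close>.
\<close>

lemma section_cocycles_ext_equiv:
  assumes eqv: "(\<xi>, \<xi>') \<in> ext_equiv K D Q W" and \<theta>: "\<theta> \<in> section_cocycles K D Q W \<xi>"
  shows "\<theta> \<in> section_cocycles K D Q W \<xi>'"
proof -
  obtain V i p V' i' p' where eq: "\<xi> = (V, i, p)" "\<xi>' = (V', i', p')"
    by (cases \<xi>, cases \<xi>') auto
  obtain f where exact: "(V, i, p) \<in> short_exact K D Q W" "(V', i', p') \<in> short_exact K D Q W"
    and f: "f \<in> rep_hom K D V V'" and f_i: "\<forall>w\<in>carrier W. f (i w) = i' w"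
    and p_f: "\<forall>v\<in>carrier V. p' (f v) = p v"
    using eqv unfolding eq ext_equiv_def by blast
  interpret V: extension K D Q W V i p
    by unfold_locales (rule exact(1))
  interpret V': extension K D Q W V' i' p'
    by unfold_locales (rule exact(2))
  have f_lin: "f \<in> lin_hom K V V'"
    and f_lam: "\<And>x v. x \<in> elems D \<Longrightarrow> v \<in> carrier V \<Longrightarrow> f (lam V x v) = lam V' x (f v)"
    and f_rho: "\<And>x v. x \<in> elems D \<Longrightarrow> v \<in> carrier V \<Longrightarrow> f (rho V x v) = rho V' x (f v)"
    using f unfolding rep_hom_def by blast+
  obtain s where \<theta>_fam: "\<theta> \<in> families D Q W" and s: "s \<in> equivariant_sections K D Q V p"
    and i\<theta>: "\<And>x q. x \<in> elems D \<Longrightarrow> q \<in> carrier Q \<Longrightarrow> i (\<theta> x q) = delta D Q V s x q"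
    using \<theta>[unfolded eq] by (rule V.section_cocyclesE) (rule that)
  note s_lin = V.sectionD(2)[OF s] and p_s = V.sectionD(3)[OF s] and s_rho = V.sectionD(4)[OF s]
  note [simp] = lin_hom_closed[OF s_lin] lin_hom_closed[OF f_lin]
  define s' where "s' = (\<lambda>q\<in>carrier Q. f (s q))"
  have "s' \<in> lin_hom K Q V'"
    by (rule lin_homI) (simp_all add: s'_def lin_hom_add[OF s_lin] lin_hom_add[OF f_lin]
        lin_hom_smult[OF s_lin] lin_hom_smult[OF f_lin])
  then have "s' \<in> equivariant_sections K D Q V' p'"
    by (simp add: equivariant_sections_def Hom_rho_def s'_def p_f p_s s_rho f_rho)
  moreover have "i' (\<theta> x q) = delta D Q V' s' x q" if xq: "x \<in> elems D" "q \<in> carrier Q" for x q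
  proof -
    have "i' (\<theta> x q) = f (delta D Q V s x q)"
      using xq f_i families_closed[OF \<theta>_fam] by (simp flip: i\<theta>)
    also have "\<dots> = delta D Q V' s' x q"
      using xq by (simp add: delta_apply s'_def f_lam
          lin_hom_minus[OF V.V.vector_space V'.V.vector_space f_lin])
    finally show ?thesis .
  qed
  ultimately show ?thesis
    unfolding eq by (rule V'.section_cocyclesI[OF \<theta>_fam])
qed

end

lemma rep_pair_action_digroup:
  assumes act: "group_action G E \<phi>" and D: "D = action_digroup G E \<phi>"
    and Q: "digroup_rep K D Q" and W: "digroup_rep K D W"
  shows "rep_pair K D Q W"
proof -
  interpret group_action G E \<phi> by fact
  interpret group G
    using group_hom group_hom.axioms(1) by blast
  have "\<phi> g \<beta> \<in> E" if "g \<in> carrier G" "\<beta> \<in> E" for g \<beta>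
    using element_image[OF that refl] .
  then show ?thesis
    using Q W unfolding rep_pair_def rep_pair_axioms_def by (auto simp: D action_digroup_def)
qed

theorem theorem36:
  fixes K :: "('k, 'm) ring_scheme"
    and G :: "('g, 'b) monoid_scheme"
    and E :: "'e set"
    and \<phi> :: "'g \<Rightarrow> 'e \<Rightarrow> 'e"
    and Q :: "('k, 'q, 'g \<times> 'e) rep"
    and W :: "('k, 'w, 'g \<times> 'e) rep"
    and D :: "('g \<times> 'e) digroup"
  assumes K: "field K"
    and char_0: "\<forall>n::nat. 0 < n \<longrightarrow> [n] \<cdot>\<^bsub>K\<^esub> \<one>\<^bsub>K\<^esub> \<noteq> \<zero>\<^bsub>K\<^esub>"
    and G: "group G" "finite (carrier G)"
    and act: "group_action G E \<phi>" "E \<noteq> {}"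
    and D: "D = action_digroup G E \<phi>"
    and Q: "digroup_rep K D Q"
    and W: "digroup_rep K D W"
    and room: "\<exists>j :: 'w \<times> 'q \<Rightarrow> 'v. inj_on j (carrier W \<times> carrier Q)"
  shows "\<exists>\<Phi> :: ('k, 'q, 'w, 'v, 'g \<times> 'e) ext set \<Rightarrow> ('g \<times> 'e \<Rightarrow> 'q \<Rightarrow> 'w) set.
           bij_betw \<Phi> (Ext1 K D Q W)
             (carrier (cocycles K D Q W A_Mod coboundaries K D Q W)) \<and>
           (\<forall>\<xi> \<in> short_exact K D Q W.
              \<Phi> (ext_equiv K D Q W `` {\<xi>}) = \<one>\<^bsub>cocycles K D Q W A_Mod coboundaries K D Q W\<^esub>
                \<longleftrightarrow> splits K D Q \<xi>)"
proof -
  interpret rep_pair K D Q W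
    using act(1) D Q W by (rule rep_pair_action_digroup)
  define \<E> :: "('k, 'q, 'w, 'v, 'g \<times> 'e) ext set" where "\<E> = short_exact K D Q W"
  define R :: "('k, 'q, 'w, 'v, 'g \<times> 'e) ext rel" where "R = ext_equiv K D Q W"
  define Z where "Z = cocycles K D Q W"
  define B where "B = coboundaries K D Q W"
  define S :: "('k, 'q, 'w, 'v, 'g \<times> 'e) ext \<Rightarrow> ('g \<times> 'e \<Rightarrow> 'q \<Rightarrow> 'w) set"
    where "S = section_cocycles K D Q W"
  have ext: "extension K D Q W V i p" if "(V, i, p) \<in> \<E>" for V i p
    using that unfolding \<E>_def by (rule extensionI) (rule refl)
  have S_subset: "S \<xi> \<subseteq> carrier Z" if "\<xi> \<in> \<E>" for \<xi>
    using that extension.section_cocycles_subset[OF ext] by (cases \<xi>) (auto simp: S_def Z_def)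
  have S_coset: "S \<xi> = B +>\<^bsub>Z\<^esub> \<theta>" if "\<xi> \<in> \<E>" "\<theta> \<in> S \<xi>" for \<xi> \<theta>
    using that extension.section_cocycles_coset[OF ext] by (cases \<xi>) (simp add: S_def Z_def B_def)
  have S_splits: "splits K D Q \<xi> \<longleftrightarrow> \<zero>\<^bsub>Z\<^esub> \<in> S \<xi>" if "\<xi> \<in> \<E>" for \<xi>
    using that extension.splits_iff_zero_section_cocycle[OF ext]
    by (cases \<xi>) (simp add: S_def Z_def)
  have S_nonempty: "S \<xi> \<noteq> {}" if "\<xi> \<in> \<E>" for \<xi>
  proof -
    obtain V i p where \<xi>: "\<xi> = (V, i, p)"
      by (cases \<xi>)
    interpret V: extension K D Q W V i p
      using that unfolding \<xi> by (rule ext)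
    have "equivariant_sections K D Q V p \<noteq> {}"
      by (rule ex_equivariant_section[OF K char_0 G(2) act D Q V.V.digroup_rep_axioms V.p_hom V.p_surj])
    then show ?thesis
      unfolding S_def \<xi> by (rule V.section_cocycles_nonempty)
  qed
  \<comment> \<open>Equivalence of extensions is the kernel of \<open>S\<close>; symmetry and transitivity come for free.\<close>
  have R_iff: "(\<xi>, \<xi>') \<in> R \<longleftrightarrow> S \<xi> = S \<xi>'" if \<xi>: "\<xi> \<in> \<E>" "\<xi>' \<in> \<E>" for \<xi> \<xi>'
  proof
    obtain \<theta> where \<theta>: "\<theta> \<in> S \<xi>"
      using S_nonempty[OF \<xi>(1)] by blast
    show "S \<xi> = S \<xi>'" if "(\<xi>, \<xi>') \<in> R"
    proof -
      have "\<theta> \<in> S \<xi>'"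
        using section_cocycles_ext_equiv[of \<xi> \<xi>' \<theta>] that \<theta> by (simp add: R_def S_def)
      then show ?thesis
        using S_coset[OF \<xi>(1) \<theta>] S_coset[OF \<xi>(2)] by simp
    qed
    show "(\<xi>, \<xi>') \<in> R" if "S \<xi> = S \<xi>'"
      using ext_equivI[of \<xi> \<xi>' \<theta>] \<xi> \<theta> that by (simp add: R_def S_def \<E>_def)
  qed
  have R_field: "\<xi> \<in> \<E> \<and> \<xi>' \<in> \<E>" if "(\<xi>, \<xi>') \<in> R" for \<xi> \<xi>'
    using that by (auto simp: R_def ext_equiv_def \<E>_def)
  have R_class: "R `` {\<xi>} = {\<xi>' \<in> \<E>. S \<xi>' = S \<xi>}" if "\<xi> \<in> \<E>" for \<xi>
    unfolding Image_singleton using R_iff[OF that] R_field by (intro Collect_cong) metis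
  have realized: "\<exists>\<xi>\<in>\<E>. \<theta> \<in> S \<xi>" if \<theta>: "\<theta> \<in> carrier Z" for \<theta>
  proof -
    obtain j :: "'w \<times> 'q \<Rightarrow> 'v" where j: "inj_on j (carrier W \<times> carrier Q)"
      using room by blast
    have "twisted_sum K D Q W \<theta> (twisted_rep Q W \<theta> j) j"
      using \<theta> j unfolding Z_def by (rule twisted_sum_twisted_rep)
    from twisted_sum.realizes_cocycle[OF this] show ?thesis
      unfolding \<E>_def S_def by (rule bexI[rotated])
  qed
  \<comment> \<open>\<open>S\<close> is constant on each class, so this union is the common value of \<open>S\<close>.\<close>
  define \<Phi> where "\<Phi> C = \<Union>(S ` C)" for C
  have \<Phi>: "\<Phi> (R `` {\<xi>}) = S \<xi>" if "\<xi> \<in> \<E>" for \<xi>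
    unfolding \<Phi>_def R_class[OF that] using that by blast
  have Ext1: "Ext1 K D Q W = (\<lambda>\<xi>. R `` {\<xi>}) ` \<E>"
    by (auto simp: Ext1_def quotient_def R_def \<E>_def)
  have quotient: "carrier (Z A_Mod B) = (\<lambda>\<theta>. B +>\<^bsub>Z\<^esub> \<theta>) ` carrier Z" "\<one>\<^bsub>Z A_Mod B\<^esub> = B"
    by (auto simp: A_FactGroup_def FactGroup_def RCOSETS_def a_r_coset_def)
  have "bij_betw \<Phi> (Ext1 K D Q W) (carrier (Z A_Mod B))"
  proof (rule bij_betw_imageI)
    show "inj_on \<Phi> (Ext1 K D Q W)"
    proof (rule inj_onI)
      fix C C' assume "C \<in> Ext1 K D Q W" "C' \<in> Ext1 K D Q W" and eq: "\<Phi> C = \<Phi> C'"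
      then obtain \<xi> \<xi>' where \<xi>: "\<xi> \<in> \<E>" "C = R `` {\<xi>}" and \<xi>': "\<xi>' \<in> \<E>" "C' = R `` {\<xi>'}"
        unfolding Ext1 by blast
      have "S \<xi> = S \<xi>'"
        using eq \<Phi>[OF \<xi>(1)] \<Phi>[OF \<xi>'(1)] \<xi>(2) \<xi>'(2) by simp
      then show "C = C'"
        using R_class[OF \<xi>(1)] R_class[OF \<xi>'(1)] \<xi>(2) \<xi>'(2) by simp
    qed
    have "\<Phi> ` Ext1 K D Q W = S ` \<E>"
      unfolding Ext1 image_image by (rule image_cong) (simp_all add: \<Phi>)
    also have "\<dots> = (\<lambda>\<theta>. B +>\<^bsub>Z\<^esub> \<theta>) ` carrier Z"
    proof
      show "S ` \<E> \<subseteq> (\<lambda>\<theta>. B +>\<^bsub>Z\<^esub> \<theta>) ` carrier Z"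
      proof (rule image_subsetI)
        fix \<xi> assume \<xi>: "\<xi> \<in> \<E>"
        then obtain \<theta> where "\<theta> \<in> S \<xi>"
          using S_nonempty by blast
        then show "S \<xi> \<in> (\<lambda>\<theta>. B +>\<^bsub>Z\<^esub> \<theta>) ` carrier Z"
          using S_coset[OF \<xi>] S_subset[OF \<xi>] by blast
      qed
      show "(\<lambda>\<theta>. B +>\<^bsub>Z\<^esub> \<theta>) ` carrier Z \<subseteq> S ` \<E>"
      proof (rule image_subsetI)
        fix \<theta> assume "\<theta> \<in> carrier Z"
        then obtain \<xi> where "\<xi> \<in> \<E>" "\<theta> \<in> S \<xi>"
          using realized by blast
        then show "B +>\<^bsub>Z\<^esub> \<theta> \<in> S ` \<E>"
          using S_coset by (intro image_eqI[of _ _ \<xi>]) simp_all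
      qed
    qed
    finally show "\<Phi> ` Ext1 K D Q W = carrier (Z A_Mod B)"
      using quotient(1) by simp
  qed
  moreover have "\<Phi> (R `` {\<xi>}) = \<one>\<^bsub>Z A_Mod B\<^esub> \<longleftrightarrow> splits K D Q \<xi>" if \<xi>: "\<xi> \<in> \<E>" for \<xi>
  proof -
    \<comment> \<open>\<open>S \<xi>\<close> is a coset, so it is \<open>B\<close> as soon as it contains \<open>0\<close>.\<close>
    have "S \<xi> = B \<longleftrightarrow> \<zero>\<^bsub>Z\<^esub> \<in> S \<xi>"
      using zero_coboundary S_coset[OF \<xi>, of "\<zero>\<^bsub>Z\<^esub>"] coboundaries_coset_zero
      by (auto simp: Z_def B_def)
    then show ?thesis
      using \<xi> by (simp add: \<Phi> quotient(2) S_splits)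
  qed
  ultimately show ?thesis
    unfolding Z_def B_def R_def \<E>_def by blast
qed

end
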